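(* Let $l\ge3$ and let $A\subset\mathbb N_0$ be an automatic set. Then there exists $C=O_{l,A}(1)$ such that for any $N\ge1$ and $\varepsilon>0$ there exist $\gg_{l,A}\varepsilon^C N$ values of $m\in[N]$ such that $A\cap[N]$ contains at least $(\alpha^l-\varepsilon)N$ $l$-term arithmetic progressions with common difference $m$, where $\alpha=|A\cap[N]|/N$.
   Context: $[N]=\{0,1,\dots,N-1\}$. A set $A\subset\mathbb N_0$ is automatic if its characteristic sequence $1_A$ is $k$-automatic for some $k\ge2$, i.e.\ there is a finite automaton $(S,s_0,\Sigma_k,\delta,\Omega,\tau)$ with $1_A(n)=\tau(\delta(s_0,(n)_k))$, where $(n)_k$ is the base-$k$ expansion of $n$ read from the most significant digit and $\delta$ is extended to words. The number of $l$-term arithmetic progressions in $A\cap[N]$ with common difference $m$ is the number of $n\in\mathbb Z$ such that $n,n+m,\dots,n+(l-1)m\in A\cap[N]$. Implied constants in $O_{l,A}$, $\gg_{l,A}$ depend only on $l$ and $A$.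
   Formalization: The number of m is bounded below by a constant times min(1,ε)^C N instead of ε^C N: for A = ℕ₀ small ε forces C ≥ 1, and then ε^C N exceeds N, the number of available m, for large ε; for ε ≤ 1 the bound is unchanged. *)

theory Defs
  imports Complex_Main "HOL-Library.Indicator_Function"
begin

text \<open>Base-\<open>k\<close> expansion without leading zeros, most significant digit first; the expansion
  of \<open>0\<close> is the empty word. The guard \<open>k < 2\<close> only ensures termination.\<close>

fun expansion :: "nat \<Rightarrow> nat \<Rightarrow> nat list" where
  "expansion k n = (if k < 2 \<or> n = 0 then [] else expansion k (n div k) @ [n mod k])"

declare expansion.simps [simp del]

record ('q, 'b) automaton =
  states :: "'q set"
  initial :: 'q
  transition :: "'q \<Rightarrow> nat \<Rightarrow> 'q"
  out_set :: "'b set"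
  out :: "'q \<Rightarrow> 'b"

text \<open>The input alphabet is \<open>{0, \<dots>, k - 1}\<close>; \<open>transition\<close> and \<open>out\<close> are unconstrained off
  the states and the alphabet.\<close>

definition finite_automaton :: "nat \<Rightarrow> ('q, 'b) automaton \<Rightarrow> bool" where
  "finite_automaton k M \<longleftrightarrow>
     finite (states M) \<and> initial M \<in> states M \<and>
     (\<forall>s\<in>states M. \<forall>d<k. transition M s d \<in> states M) \<and>
     (\<forall>s\<in>states M. out M s \<in> out_set M)"

definition run :: "('q, 'b) automaton \<Rightarrow> 'q \<Rightarrow> nat list \<Rightarrow> 'q" where
  "run M = foldl (transition M)"

text \<open>States are taken in \<^typ>\<open>nat\<close>, which loses no generality: the state set is finite.\<close>

definition automatic_seq :: "nat \<Rightarrow> (nat \<Rightarrow> 'b) \<Rightarrow> bool" where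
  "automatic_seq k f \<longleftrightarrow>
     (\<exists>M :: (nat, 'b) automaton. finite_automaton k M \<and>
        (\<forall>n. f n = out M (run M (initial M) (expansion k n))))"

definition automatic_set :: "nat set \<Rightarrow> bool" where
  "automatic_set A \<longleftrightarrow> (\<exists>k\<ge>2. automatic_seq k (indicator A :: nat \<Rightarrow> nat))"

definition num_aps :: "nat \<Rightarrow> nat set \<Rightarrow> nat \<Rightarrow> nat \<Rightarrow> nat" where
  "num_aps l A N m =
     card {n :: int. \<forall>i<l. n + int i * int m \<in> int ` (A \<inter> {..<N})}"

end

theory Submission
  imports Defs "HOL-Library.FuncSet" "HOL-Combinatorics.Cycles"
begin

text \<open>
  After passing to a power \<open>K\<close> of the base, some digit \<open>d\<close> acts on the states as an idempotent of
  minimal rank. Every word then permutes the image of \<open>d\<close> (read it and reset with \<open>d\<close>), and cutting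
  a word at a digit \<open>d\<close> multiplies permutations. The tuples of permutations that arise from
  \<open>w, w + t, \<dots>, w + (l - 1) t\<close> with \<open>D dvd t\<close> form a group \<open>\<Gamma>\<close>. Digits can be chosen such that passing
  from \<open>w\<close> to \<open>w + 1\<close> affects only one coordinate in a way that depends on the leading digits; hence,
  modulo the normal subgroup \<open>N\<close> of those elements that \<open>\<Gamma>\<close> contains in each single coordinate, the
  permutation of a word depends only on its length and on its value modulo \<open>D\<close>.

  Call a block of digits of \<open>(n, m)\<close> special if it realizes an element of \<open>N\<^sup>l\<close>. Resampling a special
  block makes the \<open>l\<close> states of \<open>n + i m\<close> independent and identically distributed, provided the top
  and bottom digits of \<open>m\<close> vanish and the rest is built from multiples of \<open>D\<close>. So on each fibre the
  mean of the product is the \<open>l\<close>-th power of the mean, and convexity gives \<open>\<alpha>\<^sup>l\<close>. A pair without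
  a special block in a window of \<open>r\<close> blocks has probability exponentially small in \<open>r\<close>, so a window
  of \<open>O(log (1 / \<epsilon>))\<close> blocks suffices, which costs only a power of \<open>\<epsilon>\<close> in the number of \<open>m\<close>.
\<close>

subsection \<open>Shifts with a prescribed digit\<close>

text \<open>An automaton may record \<open>n\<close> modulo a fixed number: if A is the set of even
  numbers, an odd m gives no progression at all. So n + i m cannot be treated as generic, and
  independence can be expected only inside cosets of a normal subgroup. Divisibility of m by D,
  imposed block by block, puts all l terms into the same coset. Their conditional means are then
  equal, and a product of equal means is what convexity compares with \<alpha>^l in the favourable
  direction.

  The second obstacle is carries, through which the addition of i m leaks from one block into the
  next. A special block therefore consists of a word between two digits d, followed by one spare
  zero; since l \<le> K, the carry from below stays in that zero.

  The exponent comes from the rate: a block fails to be special with probability at most 1 - 1/Q^2,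
  where Q is the base whose digits are the blocks. So r is about Q^2 ln (12/\<epsilon>), and three
  stretches of r blocks (the window, and one on either side of the free digits of m and the window)
  cost Q^(3 r), a fixed power of 1/\<epsilon>.\<close>

lemma int_shift_into_interval:
  fixes a b T :: int
  assumes "b > 0"
  shows "\<exists>k. T \<le> a + b * k \<and> a + b * k < T + b"
proof -
  let ?k = "- ((a - T) div b)"
  have "a + b * ?k = T + (a - T) mod b"
    by (simp add: minus_mult_div_eq_mod [symmetric] algebra_simps)
  then show ?thesis
    using assms pos_mod_bound [of b "a - T"] pos_mod_sign [of b "a - T"] by (intro exI [of _ ?k]) simp
qed

text \<open>The two conditions make \<open>d\<close> a cut: adding 1 is felt only below place
  \<open>p\<close>, so in a quotient of the words of \<open>y\<close> and \<open>y + 1\<close>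
  everything above the cut cancels. Integers are used because a progression may step below 0
  here.\<close>

definition digit_stable :: "int \<Rightarrow> int \<Rightarrow> nat \<Rightarrow> int \<Rightarrow> bool" where
  "digit_stable K d p y \<longleftrightarrow> (y div K ^ p) mod K = d \<and> (y + 1) div K ^ p = y div K ^ p"

lemma digit_stable_add_mult:
  fixes K :: int
  assumes "K > 0" "p < q"
  shows "digit_stable K d p (y + K ^ q * z) \<longleftrightarrow> digit_stable K d p y"
proof -
  have *: "(x + K ^ q * z) div K ^ p = x div K ^ p + K * (K ^ (q - p - 1) * z)" for x
  proof -
    have "K ^ q = K ^ p * (K * K ^ (q - p - 1))"
      using assms(2) by (simp flip: power_Suc power_add)
    then have "x + K ^ q * z = x + (K * (K ^ (q - p - 1) * z)) * K ^ p"
      by (simp only: ac_simps)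
    also have "\<dots> div K ^ p = K * (K ^ (q - p - 1) * z) + x div K ^ p"
      using assms(1) by (intro div_mult_self1) simp
    finally show ?thesis by simp
  qed
  have "y + K ^ q * z + 1 = (y + 1) + K ^ q * z" by simp
  then show ?thesis
    unfolding digit_stable_def by (simp only: * mod_mult_self2) simp
qed

text \<open>Induction over \<open>J\<close>: adding a multiple of \<open>K ^ q\<close> to \<rho>
  leaves the digits below place q alone, so the cuts found for earlier s survive while a cut at
  place q + B is prepared for the next s. It matters that q is uniform in u.\<close>

lemma exists_stable_digit_shift:
  fixes K d D :: int and J :: "int set"
  assumes "K \<ge> 2" "0 \<le> d" "d < K" "D > 0" "finite J" "0 \<notin> J"
  shows "\<exists>q. \<forall>u. \<exists>\<rho>. D dvd \<rho> \<and> (\<forall>s\<in>J. \<exists>p<q. digit_stable K d p (u + s * \<rho>))"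
  using assms(5,6)
proof (induction J rule: finite_induct)
  case empty
  then show ?case by (intro exI [of _ 0]) (auto intro: exI [of _ 0])
next
  case (insert s J)
  then obtain q where q: "\<And>u. \<exists>\<rho>. D dvd \<rho> \<and> (\<forall>s\<in>J. \<exists>p<q. digit_stable K d p (u + s * \<rho>))"
    by auto
  define b where "b = \<bar>s\<bar> * D"
  have b: "b > 0" using insert.prems assms(4) by (simp add: b_def)
  \<comment> \<open>The leading part can be moved in steps of b. The numbers with leading digit d
    form an interval of length \<open>K ^ B\<close>, which exceeds b by at least one unit for the
    carry caused by adding 1.\<close>
  obtain B where B: "K ^ B \<ge> b + 1"
  proof -
    have "int n < K ^ n" for n
    proof -
      have "n < 2 ^ n" by (rule less_exp)
      then have "int n < 2 ^ n" by (metis of_nat_less_iff of_nat_numeral of_nat_power)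
      also have "\<dots> \<le> K ^ n" using assms(1) by (intro power_mono) auto
      finally show ?thesis .
    qed
    from this [of "nat b"] show ?thesis using b that [of "nat b"] by simp
  qed
  show ?case
  proof (intro exI [of _ "q + B + 1"] allI)
    fix u
    obtain \<rho> where \<rho>: "D dvd \<rho>" "\<And>s. s \<in> J \<Longrightarrow> \<exists>p<q. digit_stable K d p (u + s * \<rho>)"
      using q [of u] by auto
    define a where "a = (u + s * \<rho>) div K ^ q"
    obtain k where k: "d * K ^ B \<le> a + b * k" "a + b * k < d * K ^ B + b"
      using int_shift_into_interval [OF b] by blast
    define \<sigma> where "\<sigma> = sgn s * D * k"
    have s\<sigma>: "s * \<sigma> = b * k"
      by (simp add: \<sigma>_def b_def sgn_mult abs_sgn mult.assoc) 
    define \<rho>' where "\<rho>' = \<rho> + K ^ q * \<sigma>"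
    have D: "D dvd \<rho>'" using \<rho>(1) by (simp add: \<rho>'_def \<sigma>_def)
    have old: "\<exists>p<q + B + 1. digit_stable K d p (u + s' * \<rho>')" if s': "s' \<in> J" for s'
    proof -
      obtain p where p: "p < q" "digit_stable K d p (u + s' * \<rho>)" using \<rho>(2) [OF s'] by blast
      have eq: "u + s' * \<rho>' = u + s' * \<rho> + K ^ q * (s' * \<sigma>)" by (simp add: \<rho>'_def algebra_simps)
      have "digit_stable K d p (u + s' * \<rho>')"
        unfolding eq using p assms(1) by (subst digit_stable_add_mult) auto
      then show ?thesis using p(1) by (intro exI [of _ p]) simp
    qed
    have new: "digit_stable K d (q + B) (u + s * \<rho>')"
    proof -
      let ?y = "u + s * \<rho>'"
      have Kq: "K ^ q > 0" "K ^ B > 0" using assms(1) by auto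
      have "?y = u + s * \<rho> + (s * \<sigma>) * K ^ q" by (simp add: \<rho>'_def algebra_simps)
      also have "\<dots> div K ^ q = s * \<sigma> + (u + s * \<rho>) div K ^ q"
        by (rule div_mult_self1) (use Kq in linarith)
      finally have y: "?y div K ^ q = a + b * k"
        by (simp add: a_def s\<sigma>)
      have y1: "?y div K ^ q \<le> (?y + 1) div K ^ q" "(?y + 1) div K ^ q \<le> ?y div K ^ q + 1"
      proof -
        show "?y div K ^ q \<le> (?y + 1) div K ^ q" using Kq by (intro zdiv_mono1) auto
        have "(?y + 1) div K ^ q \<le> (?y + 1 * K ^ q) div K ^ q" using Kq by (intro zdiv_mono1) auto
        also have "\<dots> = 1 + ?y div K ^ q"
          by (rule div_mult_self1) (use Kq in linarith)
        finally show "(?y + 1) div K ^ q \<le> ?y div K ^ q + 1" by simp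
      qed
      have dv: "z div K ^ B = d" if "d * K ^ B \<le> z" "z < d * K ^ B + K ^ B" for z
      proof -
        have "z = (z - d * K ^ B) + d * K ^ B" by simp
        then have "z div K ^ B = d + (z - d * K ^ B) div K ^ B" using Kq
          by (metis add.commute div_mult_self1 less_irrefl)
        also have "(z - d * K ^ B) div K ^ B = 0" using that by (intro div_pos_pos_trivial) auto
        finally show ?thesis by simp
      qed
      have sp: "z div K ^ (q + B) = z div K ^ q div K ^ B" for z
        using Kq by (simp add: power_add zdiv_zmult2_eq)
      have "?y div K ^ (q + B) = d" unfolding sp y using k B by (intro dv) auto
      moreover have "(?y + 1) div K ^ (q + B) = d" unfolding sp using k B y y1 by (intro dv) auto
      ultimately show ?thesis using assms(1-3) by (simp add: digit_stable_def)
    qed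
    show "\<exists>\<rho>. D dvd \<rho> \<and> (\<forall>s\<in>insert s J. \<exists>p<q + B + 1. digit_stable K d p (u + s * \<rho>))"
      using D old new by (intro exI [of _ \<rho>']) auto
  qed
qed

text \<open>A large multiple of \<open>K ^ q\<close> repairs the sign of \<rho> without touching the
  cuts.\<close>

lemma exists_nonneg_stable_digit_shift:
  fixes K d D :: int and J :: "int set"
  assumes "K \<ge> 2" "0 \<le> d" "d < K" "D > 0" "finite J" "0 \<notin> J"
  shows "\<exists>q. \<forall>u. \<exists>\<rho>\<ge>0. D dvd \<rho> \<and> (\<forall>s\<in>J. \<exists>p<q. digit_stable K d p (u + s * \<rho>))"
proof -
  obtain q where q: "\<And>u. \<exists>\<rho>. D dvd \<rho> \<and> (\<forall>s\<in>J. \<exists>p<q. digit_stable K d p (u + s * \<rho>))"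
    using exists_stable_digit_shift [OF assms] by blast
  show ?thesis
  proof (intro exI [of _ q] allI)
    fix u
    obtain \<rho> where \<rho>: "D dvd \<rho>" "\<And>s. s \<in> J \<Longrightarrow> \<exists>p<q. digit_stable K d p (u + s * \<rho>)"
      using q [of u] by auto
    have "1 \<le> K ^ q * D" using assms(1,4) by (simp add: int_one_le_iff_zero_less)
    then have "1 * \<bar>\<rho>\<bar> \<le> K ^ q * D * \<bar>\<rho>\<bar>" by (intro mult_right_mono) auto
    then have nn: "\<rho> + K ^ q * (D * \<bar>\<rho>\<bar>) \<ge> 0" by (simp add: mult.assoc)
    have "\<exists>p<q. digit_stable K d p (u + s * (\<rho> + K ^ q * (D * \<bar>\<rho>\<bar>)))" if s: "s \<in> J" for s
    proof -
      have eq: "u + s * (\<rho> + K ^ q * (D * \<bar>\<rho>\<bar>)) = u + s * \<rho> + K ^ q * (s * (D * \<bar>\<rho>\<bar>))"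
        by (simp add: algebra_simps)
      obtain p where "p < q" "digit_stable K d p (u + s * \<rho>)" using \<rho>(2) [OF s] by blast
      then show ?thesis
        unfolding eq using digit_stable_add_mult [of K p q d] assms(1) by auto
    qed
    then show "\<exists>\<rho>\<ge>0. D dvd \<rho> \<and> (\<forall>s\<in>J. \<exists>p<q. digit_stable K d p (u + s * \<rho>))"
      using \<rho>(1) nn by (intro exI [of _ "\<rho> + K ^ q * (D * \<bar>\<rho>\<bar>)"]) auto
  qed
qed

subsection \<open>Exponents and cosets in non-commutative additive groups\<close>

lemmas group_add_normalize =
  diff_conv_add_uminus minus_add add.assoc minus_minus minus_zero
  minus_add_cancel add_minus_cancel left_minus right_minus add_0_left add_0_right

primrec npow :: "nat \<Rightarrow> 'g::monoid_add \<Rightarrow> 'g" where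
  "npow 0 g = 0"
| "npow (Suc n) g = g + npow n g"

lemma npow_add: "npow (m + n) g = npow m g + npow n g"
  by (induction m) (simp_all add: add.assoc)

lemma npow_mult: "npow (m * n) g = npow m (npow n g)"
  by (induction m) (simp_all add: npow_add)

lemma npow_zero [simp]: "npow n 0 = 0"
  by (induction n) simp_all

lemma npow_commute: "npow n g + g = g + npow n g"
  by (induction n) (simp_all add: add.assoc)

lemma npow_minus_one:
  fixes g :: "'g::group_add"
  assumes "npow D g = 0" "D > 0"
  shows "npow (D - 1) g = - g"
proof -
  have "g + npow (D - 1) g = 0" using assms(1,2) by (metis Suc_diff_1 npow.simps(2))
  then have "- g = npow (D - 1) g" by (rule minus_unique)
  then show ?thesis by simp
qed

lemma npow_dvd:
  fixes g :: "'g::group_add"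
  assumes "npow D g = 0" "D dvd n"
  shows "npow n g = 0"
proof -
  obtain j where "n = j * D" using assms(2) by (auto simp: dvd_def mult.commute)
  then show ?thesis using assms(1) by (simp add: npow_mult)
qed

lemma npow_cong_mod:
  fixes g :: "'g::group_add"
  assumes "npow D g = 0" "m mod D = n mod D"
  shows "npow m g = npow n g"
proof -
  have "npow m g = npow (m mod D) g" for m
  proof -
    have "npow (D * (m div D) + m mod D) g = npow (m mod D) g"
      unfolding npow_add using npow_dvd [OF assms(1), of "D * (m div D)"] by simp
    then show ?thesis by simp
  qed
  from this [of m] this [of n] show ?thesis using assms(2) by simp
qed

lemma finite_exponent:
  fixes G :: "'g::group_add set"
  assumes "finite G" "0 \<in> G" "\<And>x y. x \<in> G \<Longrightarrow> y \<in> G \<Longrightarrow> x + y \<in> G"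
  shows "\<exists>D>0. \<forall>g\<in>G. npow D g = 0"
proof -
  have "\<exists>e>0. npow e g = 0" if g: "g \<in> G" for g
  proof -
    have mem: "npow n g \<in> G" for n
      using g assms by (induction n) auto
    have "\<not> inj (\<lambda>n. npow n g)"
      using finite_subset [of "range (\<lambda>n. npow n g)" G] mem assms(1) finite_imageD [of "\<lambda>n. npow n g" UNIV]
        infinite_UNIV_nat by blast
    then obtain i j where "i \<noteq> j" "npow i g = npow j g" by (auto simp: inj_on_def)
    then obtain i j where ij: "i < j" "npow i g = npow j g" by (metis linorder_neqE_nat)
    then have "npow (i + (j - i)) g = npow i g" by simp
    then have "npow (j - i) g = 0" 
      using add_left_imp_eq [of "npow i g" "npow (j - i) g" 0] by (simp add: npow_add)
    then show ?thesis using ij by (intro exI [of _ "j - i"]) auto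
  qed
  then obtain e where e: "\<And>g. g \<in> G \<Longrightarrow> e g > 0 \<and> npow (e g) g = 0" by metis
  show ?thesis
  proof (intro exI [of _ "prod e G"] conjI ballI)
    show "prod e G > 0" by (rule prod_pos) (use e in blast)
    show "npow (prod e G) g = 0" if "g \<in> G" for g
      by (rule npow_dvd [of "e g"]) (use e [OF that] dvd_prodI [OF assms(1) that] in blast)+
  qed
qed

locale normal_subgroup_in =
  fixes G N :: "'g::group_add set"
  assumes add_G: "x \<in> G \<Longrightarrow> y \<in> G \<Longrightarrow> x + y \<in> G"
    and uminus_G: "x \<in> G \<Longrightarrow> - x \<in> G"
    and zero_N: "0 \<in> N"
    and add_N: "x \<in> N \<Longrightarrow> y \<in> N \<Longrightarrow> x + y \<in> N"
    and uminus_N: "x \<in> N \<Longrightarrow> - x \<in> N"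
    and conj_N: "x \<in> G \<Longrightarrow> g \<in> N \<Longrightarrow> x + g - x \<in> N"
begin

text \<open>Equality of left cosets of \<open>N\<close>.\<close>

definition eqv :: "'g \<Rightarrow> 'g \<Rightarrow> bool" (infix "\<approx>" 50) where
  "x \<approx> y \<longleftrightarrow> - x + y \<in> N"

lemma conj_N': "x \<in> G \<Longrightarrow> g \<in> N \<Longrightarrow> - x + g + x \<in> N"
  using conj_N [of "- x" g] uminus_G [of x] by simp

lemma eqv_refl [simp]: "x \<approx> x"
  by (simp add: eqv_def zero_N)

lemma eqv_sym: "x \<approx> y \<Longrightarrow> y \<approx> x"
  using uminus_N [of "- x + y"] by (simp add: eqv_def minus_add)

lemma eqv_trans [trans]: "x \<approx> y \<Longrightarrow> y \<approx> z \<Longrightarrow> x \<approx> z"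
  using add_N [of "- x + y" "- y + z"] by (simp add: eqv_def add.assoc)

lemma eqv_add_left: "y \<approx> z \<Longrightarrow> x + y \<approx> x + z"
  by (simp only: eqv_def group_add_normalize)

lemma eqv_add_right: "y \<approx> z \<Longrightarrow> x \<in> G \<Longrightarrow> y + x \<approx> z + x"
  using conj_N' [of x "- y + z"] by (simp only: eqv_def group_add_normalize)

text \<open>By normality the set a + N + b depends only on the cosets of a and b. This is what will
  make the means of all l terms equal.\<close>

lemma sum_coset_eq:
  assumes "a \<approx> a'" "b \<approx> b'" "b \<in> G" "b' \<in> G"
  shows "(\<Sum>g\<in>N. F (a + g + b)) = (\<Sum>g\<in>N. F (a' + g + b'))"
proof -
  have 1: "- a + a' \<in> N" "- a' + a \<in> N" using assms(1) eqv_sym by (auto simp: eqv_def)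
  have 2: "b' - b \<in> N" "b - b' \<in> N"
  proof -
    have "- b + b' \<in> N" "- b' + b \<in> N" using assms(2) eqv_sym by (auto simp: eqv_def)
    then have "b + (- b + b') - b \<in> N" "b' + (- b' + b) - b' \<in> N"
      using conj_N assms(3,4) by blast+
    then show "b' - b \<in> N" "b - b' \<in> N" by (simp_all only: group_add_normalize)
  qed
  show ?thesis
  proof (rule sum.reindex_bij_witness [where i = "\<lambda>g. - a + a' + g + (b' - b)"
          and j = "\<lambda>g. - a' + a + g + (b - b')"])
    fix g assume g: "g \<in> N"
    show "- a + a' + (- a' + a + g + (b - b')) + (b' - b) = g"
      by (simp only: group_add_normalize)
    show "- a' + a + (- a + a' + g + (b' - b)) + (b - b') = g"
      by (simp only: group_add_normalize)
    show "- a' + a + g + (b - b') \<in> N" "- a + a' + g + (b' - b) \<in> N"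
      using g 1 2 add_N by blast+
    show "F (a' + (- a' + a + g + (b - b')) + b') = F (a + g + b)"
      by (simp only: group_add_normalize)
  qed
qed

end

subsection \<open>The group of progressions\<close>

text \<open>\<open>\<phi> h n\<close> stands for the permutation of the image of d that is induced
  by the h lowest digits of n followed by d. A digit d inside the word cuts it into a product in
  reading order, which is \<open>\<phi>_split\<close>.\<close>

locale block_group =
  fixes K d l D :: nat and \<phi> :: "nat \<Rightarrow> nat \<Rightarrow> 'g::group_add"
  assumes K_ge_2: "2 \<le> K" and d_less: "d < K"
    and finite_\<phi>: "finite {\<phi> h n |h n. True}"
    and \<phi>_0 [simp]: "\<phi> 0 n = 0"
    and \<phi>_mod: "\<phi> h (n mod K ^ h) = \<phi> h n"
    and \<phi>_split: "(n div K ^ h2) mod K = d \<Longrightarrow>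
      \<phi> (h1 + Suc h2) n = \<phi> h1 (n div K ^ Suc h2) + \<phi> h2 n"
    and D_pos: "D > 0"
    and D_exponent: "npow D (\<phi> h n) = 0"
begin

definition G :: "'g set" where
  "G = {\<phi> h n |h n. True}"

lemma \<phi>_in_G [simp]: "\<phi> h n \<in> G"
  by (auto simp: G_def)

lemma K_pos [simp]: "0 < K"
  using K_ge_2 by simp

lemma \<phi>_join:
  assumes "n2 < K ^ h2"
  shows "\<phi> (h1 + Suc h2) (n1 * K ^ Suc h2 + d * K ^ h2 + n2) = \<phi> h1 n1 + \<phi> h2 n2"
proof -
  let ?n = "n1 * K ^ Suc h2 + d * K ^ h2 + n2"
  have n: "?n = n2 + K ^ h2 * (n1 * K + d)" by (simp add: algebra_simps)
  have 1: "?n div K ^ h2 = n1 * K + d" unfolding n using assms by (simp add: div_mult_self4)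
  have 2: "?n div K ^ Suc h2 = n1"
    using 1 d_less by (simp add: power_Suc2 div_mult2_eq del: power_Suc)
  have 3: "?n mod K ^ h2 = n2" unfolding n using assms by simp
  have "\<phi> (h1 + Suc h2) ?n = \<phi> h1 (?n div K ^ Suc h2) + \<phi> h2 ?n"
    by (rule \<phi>_split) (use 1 d_less in simp)
  then show ?thesis using 2 3 \<phi>_mod [of h2 ?n] by simp
qed

lemma \<phi>_append_d: "\<phi> (Suc h) (n * K + d) = \<phi> h n"
  using \<phi>_join [of 0 0 h n] by simp

lemma npow_D: "g \<in> G \<Longrightarrow> npow D g = 0"
  by (auto simp: G_def D_exponent)

lemma zero_in_G: "0 \<in> G"
  using \<phi>_in_G [of 0 0] by (simp del: \<phi>_in_G)

lemma add_in_G: "x \<in> G \<Longrightarrow> y \<in> G \<Longrightarrow> x + y \<in> G"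
proof -
  assume "x \<in> G" "y \<in> G"
  then obtain h1 n1 h2 n2 where "x = \<phi> h1 n1" "y = \<phi> h2 n2" by (auto simp: G_def)
  then have "x + y = \<phi> h1 n1 + \<phi> h2 (n2 mod K ^ h2)" by (simp add: \<phi>_mod)
  then show ?thesis using \<phi>_join [of "n2 mod K ^ h2" h2 h1 n1] by (metis \<phi>_in_G K_pos mod_less_divisor zero_less_power)
qed

lemma npow_in_G: "x \<in> G \<Longrightarrow> npow n x \<in> G"
  by (induction n) (auto intro: add_in_G zero_in_G)

lemma uminus_in_G: "x \<in> G \<Longrightarrow> - x \<in> G"
  using npow_minus_one [OF npow_D D_pos, of x] npow_in_G [of x "D - 1"] by simp

text \<open>The bound on the last term keeps every term within h digits, so no carry leaves the
  word.\<close>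

definition ap_tuple :: "nat \<Rightarrow> (nat \<Rightarrow> 'g) \<Rightarrow> bool" where
  "ap_tuple h \<gamma> \<longleftrightarrow> (\<exists>w t. D dvd t \<and> w + (l - 1) * t < K ^ h \<and> (\<forall>i<l. \<gamma> i = \<phi> h (w + i * t)))"

lemma ap_bound:
  assumes "w + (l - 1) * t < B" "i < l"
  shows "w + i * t < (B::nat)"
proof -
  have "i * t \<le> (l - 1) * t" using assms(2) by (intro mult_right_mono) auto
  then show ?thesis using assms(1) by linarith
qed

lemma ap_tuple_add:
  assumes "ap_tuple h1 \<gamma>1" "ap_tuple h2 \<gamma>2"
  shows "ap_tuple (h1 + Suc h2) (\<lambda>i. \<gamma>1 i + \<gamma>2 i)"
proof -
  obtain w1 t1 where 1: "D dvd t1" "w1 + (l - 1) * t1 < K ^ h1" "\<And>i. i < l \<Longrightarrow> \<gamma>1 i = \<phi> h1 (w1 + i * t1)"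
    using assms(1) by (auto simp: ap_tuple_def)
  obtain w2 t2 where 2: "D dvd t2" "w2 + (l - 1) * t2 < K ^ h2" "\<And>i. i < l \<Longrightarrow> \<gamma>2 i = \<phi> h2 (w2 + i * t2)"
    using assms(2) by (auto simp: ap_tuple_def)
  let ?w = "w1 * K ^ Suc h2 + d * K ^ h2 + w2" and ?t = "t1 * K ^ Suc h2 + t2"
  have eq: "?w + i * ?t = (w1 + i * t1) * K ^ Suc h2 + d * K ^ h2 + (w2 + i * t2)" for i
    by (simp add: algebra_simps)
  show ?thesis unfolding ap_tuple_def
  proof (intro exI conjI allI impI)
    show "D dvd ?t" using 1 2 by simp
    show "\<gamma>1 i + \<gamma>2 i = \<phi> (h1 + Suc h2) (?w + i * ?t)" if "i < l" for i
      unfolding eq using 1(3) [OF that] 2(3) [OF that] ap_bound [OF 2(2) that] by (simp only: \<phi>_join)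
    have "(w1 + (l - 1) * t1) * K ^ Suc h2 + d * K ^ h2 + (w2 + (l - 1) * t2)
        < (w1 + (l - 1) * t1) * K ^ Suc h2 + d * K ^ h2 + K ^ h2" using 2(2) by simp
    also have "\<dots> = (w1 + (l - 1) * t1) * K ^ Suc h2 + (d + 1) * K ^ h2" by (simp add: algebra_simps)
    also have "\<dots> \<le> (w1 + (l - 1) * t1) * K ^ Suc h2 + K * K ^ h2"
      using d_less by (intro add_left_mono mult_right_mono) auto
    also have "\<dots> = (w1 + (l - 1) * t1 + 1) * K ^ Suc h2" by (simp add: algebra_simps)
    also have "\<dots> \<le> K ^ h1 * K ^ Suc h2" using 1(2) by (intro mult_right_mono) auto
    finally show "?w + (l - 1) * ?t < K ^ (h1 + Suc h2)" unfolding eq by (simp only: power_add)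
  qed
qed

text \<open>The empty word behind a cut costs one digit and contributes the identity, so
  realizations can be padded to any greater length.\<close>

lemma ap_tuple_Suc:
  assumes "ap_tuple h \<gamma>"
  shows "ap_tuple (Suc h) \<gamma>"
proof -
  have "ap_tuple 0 (\<lambda>_. 0)" unfolding ap_tuple_def by (intro exI [of _ 0]) simp
  from ap_tuple_add [OF assms this] show ?thesis by simp
qed

lemma ap_tuple_mono: "h \<le> h' \<Longrightarrow> ap_tuple h \<gamma> \<Longrightarrow> ap_tuple h' \<gamma>"
  by (induction rule: dec_induct) (auto intro: ap_tuple_Suc)

definition \<Gamma> :: "(nat \<Rightarrow> 'g) \<Rightarrow> bool" where
  "\<Gamma> \<gamma> \<longleftrightarrow> (\<exists>h. ap_tuple h \<gamma>)"

lemma \<Gamma>_cong: "\<Gamma> \<gamma> \<Longrightarrow> (\<And>i. i < l \<Longrightarrow> \<gamma> i = \<gamma>' i) \<Longrightarrow> \<Gamma> \<gamma>'"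
  by (auto simp: \<Gamma>_def ap_tuple_def)

lemma \<Gamma>_in_G: "\<Gamma> \<gamma> \<Longrightarrow> i < l \<Longrightarrow> \<gamma> i \<in> G"
  by (auto simp: \<Gamma>_def ap_tuple_def)

lemma \<Gamma>_add: "\<Gamma> \<gamma>1 \<Longrightarrow> \<Gamma> \<gamma>2 \<Longrightarrow> \<Gamma> (\<lambda>i. \<gamma>1 i + \<gamma>2 i)"
  unfolding \<Gamma>_def using ap_tuple_add by blast

lemma \<Gamma>_diag: "x \<in> G \<Longrightarrow> \<Gamma> (\<lambda>_. x)"
proof -
  assume "x \<in> G"
  then obtain h n where "x = \<phi> h n" by (auto simp: G_def)
  then have "ap_tuple h (\<lambda>_. x)" unfolding ap_tuple_def
    by (intro exI [of _ "n mod K ^ h"] exI [of _ 0]) (simp add: \<phi>_mod)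
  then show ?thesis by (auto simp: \<Gamma>_def)
qed

text \<open>The finite exponent turns inverses into positive powers, and these are realized by
  words.\<close>

lemma \<Gamma>_uminus:
  assumes "\<Gamma> \<gamma>"
  shows "\<Gamma> (\<lambda>i. - \<gamma> i)"
proof -
  have "\<Gamma> (\<lambda>i. npow n (\<gamma> i))" for n
  proof (induction n)
    case 0
    then show ?case using \<Gamma>_diag [OF zero_in_G] by simp
  next
    case (Suc n)
    then show ?case using \<Gamma>_add [OF assms Suc] by simp
  qed
  from this [of "D - 1"] show ?thesis
    by (rule \<Gamma>_cong) (use npow_minus_one [OF npow_D D_pos] \<Gamma>_in_G [OF assms] in auto)
qed

section \<open>Elements confined to a single coordinate\<close>

definition at_coord :: "nat \<Rightarrow> 'g \<Rightarrow> nat \<Rightarrow> 'g" where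
  "at_coord i g = (\<lambda>j. if j = i then g else 0)"

definition N :: "nat \<Rightarrow> 'g set" where
  "N i = {g. \<Gamma> (at_coord i g)}"

text \<open>Conjugation by x is carried out with the diagonal tuple of x, which comes from a
  progression with step 0.\<close>

lemma N_normal:
  assumes "i < l"
  shows "normal_subgroup_in G (N i)"
proof
  show "0 \<in> N i" unfolding N_def
    using \<Gamma>_diag [OF zero_in_G] by (simp add: at_coord_def)
  show "x + y \<in> N i" if "x \<in> N i" "y \<in> N i" for x y
  proof -
    have "\<Gamma> (\<lambda>j. at_coord i x j + at_coord i y j)"
      using that by (intro \<Gamma>_add) (auto simp: N_def)
    then show ?thesis unfolding N_def mem_Collect_eq
      by (rule \<Gamma>_cong) (auto simp: at_coord_def)
  qed
  show "- x \<in> N i" if "x \<in> N i" for x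
  proof -
    have "\<Gamma> (\<lambda>j. - at_coord i x j)"
      using that by (intro \<Gamma>_uminus) (auto simp: N_def)
    then show ?thesis unfolding N_def mem_Collect_eq
      by (rule \<Gamma>_cong) (auto simp: at_coord_def)
  qed
  show "x + g - x \<in> N i" if "x \<in> G" "g \<in> N i" for x g
  proof -
    have "\<Gamma> (\<lambda>j. x + at_coord i g j + - x)"
      using that by (intro \<Gamma>_add \<Gamma>_diag uminus_in_G) (auto simp: N_def)
    then show ?thesis unfolding N_def mem_Collect_eq
      by (rule \<Gamma>_cong) (auto simp: at_coord_def)
  qed
qed (auto intro: add_in_G uminus_in_G)

text \<open>Prefixing \<open>w\<close> with a long word that ends in \<open>d\<close> makes the progression around \<open>w\<close> with step \<open>\<rho>\<close>
  possible. All its members except \<open>w\<close> itself contain a \<open>d\<close> above which nothing changes when \<open>1\<close> is added,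
  so there the leading digits cancel in the quotient of the two tuples.\<close>

lemma increment_local:
  assumes "i0 < l"
  shows "\<exists>q. \<forall>u h1 w1 h2 w2. w1 * K ^ q + u + 1 < K ^ (h1 + q) \<longrightarrow> w2 * K ^ q + u + 1 < K ^ (h2 + q) \<longrightarrow>
    - (- \<phi> (h1 + q) (w1 * K ^ q + u) + \<phi> (h1 + q) (w1 * K ^ q + u + 1))
    + (- \<phi> (h2 + q) (w2 * K ^ q + u) + \<phi> (h2 + q) (w2 * K ^ q + u + 1)) \<in> N i0"
proof -
  define J where "J = (\<lambda>i. int i - int i0) ` ({..<l} - {i0})"
  have "\<exists>q. \<forall>u. \<exists>\<rho>\<ge>0. int D dvd \<rho> \<and> (\<forall>s\<in>J. \<exists>p<q. digit_stable (int K) (int d) p (u + s * \<rho>))"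
    by (rule exists_nonneg_stable_digit_shift) (use K_ge_2 d_less D_pos in \<open>auto simp: J_def\<close>)
  then obtain q where q: "\<And>u. \<exists>\<rho>\<ge>0. int D dvd \<rho> \<and> (\<forall>s\<in>J. \<exists>p<q. digit_stable (int K) (int d) p (u + s * \<rho>))"
    by blast
  show ?thesis
  proof (intro exI [of _ q] allI impI)
    fix u h1 w1 h2 w2
    assume W1: "w1 * K ^ q + u + 1 < K ^ (h1 + q)" and W2: "w2 * K ^ q + u + 1 < K ^ (h2 + q)"
    obtain \<rho> where "\<rho> \<ge> 0" "int D dvd \<rho>" "\<forall>s\<in>J. \<exists>p<q. digit_stable (int K) (int d) p (int u + s * \<rho>)"
      using q [of "int u"] by auto
    then obtain R where R: "D dvd R" "\<forall>s\<in>J. \<exists>p<q. digit_stable (int K) (int d) p (int u + s * int R)"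
      by (metis nat_0_le int_dvd_int_iff)
    define g where "g = l * R"
    have g: "l * R \<le> K ^ g"
    proof -
      have "g < 2 ^ g" by (rule less_exp)
      also have "\<dots> \<le> K ^ g" using K_ge_2 by (intro power_mono) auto
      finally show ?thesis by (simp add: g_def)
    qed
    \<comment> \<open>The prefix \<open>K ^ g\<close> exceeds the span \<open>l * R\<close>, so the
      progression can start at \<open>Z h w - i0 * R\<close>; the digit d behind it cuts the word of
      the term i0. Length g + 2 leaves room for overflow into the prefix.\<close>
    define Z where "Z h w = (K ^ g * K + d) * K ^ (h + q) + (w * K ^ q + u)" for h w
    define H where "H h = (g + 2) + Suc (h + q)" for h
    define A where "A h w i = - \<phi> (H h) (Z h w - i0 * R + i * R) + \<phi> (H h) (Z h w + 1 - i0 * R + i * R)"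
      for h w i
    \<comment> \<open>For i different from i0 the right-hand side mentions neither h nor w: what
      lies above the stable digit has cancelled.\<close>
    have main: "\<Gamma> (A h w) \<and> A h w i0 = - \<phi> (h + q) (w * K ^ q + u) + \<phi> (h + q) (w * K ^ q + u + 1) \<and>
        (\<forall>i<l. \<forall>p<q. digit_stable (int K) (int d) p (int u + (int i - int i0) * int R) \<longrightarrow>
          A h w i = - \<phi> p (nat ((int u + (int i - int i0) * int R) mod int K ^ p))
            + \<phi> p (nat ((int u + (int i - int i0) * int R + 1) mod int K ^ p)))"
      if W: "w * K ^ q + u + 1 < K ^ (h + q)" for h w
    proof (intro conjI allI impI)
      have i0R: "i0 * R \<le> l * R" using assms by simp
      have Kh: "1 \<le> K ^ (h + q)" by (simp add: Suc_le_eq)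
      have low: "K ^ g \<le> Z h w"
      proof -
        have "K ^ g * 1 * 1 \<le> K ^ g * K * K ^ (h + q)" using K_ge_2 by (intro mult_mono) auto
        then show ?thesis unfolding Z_def add_mult_distrib by linarith
      qed
      have i0Z: "i0 * R \<le> Z h w" using i0R g low by linarith
      have high: "Z h w + 1 + l * R < K ^ H h"
      proof -
        have "Z h w + 1 + l * R < (K ^ g * K + d) * K ^ (h + q) + K ^ (h + q) + K ^ g"
          using W g by (simp add: Z_def)
        also have "\<dots> \<le> (K ^ g * K + K) * K ^ (h + q) + K ^ g * K ^ (h + q)"
        proof -
          have "(K ^ g * K + d + 1) * K ^ (h + q) \<le> (K ^ g * K + K) * K ^ (h + q)"
            using d_less by (intro mult_right_mono) auto
          moreover have "K ^ g * 1 \<le> K ^ g * K ^ (h + q)" using Kh by (intro mult_left_mono) auto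
          ultimately show ?thesis unfolding add_mult_distrib by linarith
        qed
        also have "\<dots> = (K ^ g * K + K + K ^ g) * K ^ (h + q)" by (simp add: algebra_simps)
        also have "\<dots> \<le> (K ^ g * K * K * K) * K ^ (h + q)"
        proof (intro mult_right_mono)
          have a: "1 * K \<le> K ^ g * K" by (intro mult_right_mono) (auto simp: Suc_le_eq)
          have b: "K ^ g * 1 \<le> K ^ g * K" using K_ge_2 by (intro mult_left_mono) auto
          have c: "K ^ g * K * (2 * 2) \<le> K ^ g * K * (K * K)"
            using K_ge_2 by (intro mult_left_mono mult_mono) auto
          have "K ^ g * K + K + K ^ g \<le> K ^ g * K * 4" using a b by linarith
          also have "\<dots> \<le> K ^ g * K * K * K" using c by (simp add: mult.assoc)
          finally show "K ^ g * K + K + K ^ g \<le> K ^ g * K * K * K" .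
        qed simp
        also have "\<dots> = K ^ H h" by (simp add: H_def power_add algebra_simps)
        finally show ?thesis .
      qed
      have T: "ap_tuple (H h) (\<lambda>i. \<phi> (H h) (Z h w + b - i0 * R + i * R))" if "b \<le> 1" for b
        unfolding ap_tuple_def
      proof (intro exI conjI allI impI)
        have "(l - 1) * R \<le> l * R" by simp
        then show "Z h w + b - i0 * R + (l - 1) * R < K ^ H h" using high that by linarith
      qed (use R in auto)
      have "ap_tuple (H h) (\<lambda>i. \<phi> (H h) (Z h w - i0 * R + i * R))" using T [of 0] by simp
      then show "\<Gamma> (A h w)"
        unfolding A_def using T [of 1] by (intro \<Gamma>_add \<Gamma>_uminus) (auto simp: \<Gamma>_def)
      have Zi0: "Z h w - i0 * R + i0 * R = Z h w" "Z h w + 1 - i0 * R + i0 * R = Z h w + 1"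
        using i0Z by simp_all
      have Zform: "Z h w = K ^ g * K ^ Suc (h + q) + d * K ^ (h + q) + (w * K ^ q + u)"
        "Z h w + 1 = K ^ g * K ^ Suc (h + q) + d * K ^ (h + q) + (w * K ^ q + u + 1)"
        by (simp_all add: Z_def algebra_simps)
      have "\<phi> (H h) (Z h w) = \<phi> (g + 2) (K ^ g) + \<phi> (h + q) (w * K ^ q + u)"
        unfolding Zform(1) H_def by (rule \<phi>_join) (use W in simp)
      moreover have "\<phi> (H h) (Z h w + 1) = \<phi> (g + 2) (K ^ g) + \<phi> (h + q) (w * K ^ q + u + 1)"
        unfolding Zform(2) H_def by (rule \<phi>_join) (rule W)
      ultimately show "A h w i0 = - \<phi> (h + q) (w * K ^ q + u) + \<phi> (h + q) (w * K ^ q + u + 1)"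
        unfolding A_def Zi0 by (simp only: group_add_normalize)
      fix i p assume i: "i < l" and p: "p < q"
        and st: "digit_stable (int K) (int d) p (int u + (int i - int i0) * int R)"
      let ?v = "int u + (int i - int i0) * int R"
      define Y where "Y = Z h w - i0 * R + i * R"
      have Y1: "Z h w + 1 - i0 * R + i * R = Y + 1" using i0Z by (simp add: Y_def)
      define z where "z = (int K ^ g * int K + int d) * int K ^ h + int w"
      have "int Y = int (Z h w) + (int i - int i0) * int R"
        using i0Z by (simp add: Y_def of_nat_diff algebra_simps)
      then have Yv: "int Y = ?v + int K ^ q * z"
        by (simp add: Z_def z_def algebra_simps power_add)
      have "digit_stable (int K) (int d) p (int Y)"
        unfolding Yv using st p by (subst digit_stable_add_mult) auto
      then have "int ((Y div K ^ p) mod K) = int d" "int ((Y + 1) div K ^ p) = int (Y div K ^ p)"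
        by (simp_all add: digit_stable_def zdiv_int zmod_int add.commute)
      then have dg: "(Y div K ^ p) mod K = d" "(Y + 1) div K ^ p = Y div K ^ p"
        by (simp_all only: of_nat_eq_iff)
      have dg': "((Y + 1) div K ^ p) mod K = d" "(Y + 1) div K ^ Suc p = Y div K ^ Suc p"
        using dg by (simp_all add: power_Suc2 div_mult2_eq del: power_Suc)
      have Hp: "H h = (H h - Suc p) + Suc p" using p by (simp add: H_def)
      have md: "\<phi> p x = \<phi> p (nat (y mod int K ^ p))" if "int x = y + int K ^ q * z" for x y
      proof -
        have "int K ^ q = int K ^ p * int K ^ (q - p)" using p by (simp flip: power_add)
        then have "int x mod int K ^ p = y mod int K ^ p"
          unfolding that by (simp add: mult.assoc)
        then have "nat (y mod int K ^ p) = x mod K ^ p"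
          by (metis nat_int of_nat_power zmod_int)
        then show ?thesis by (simp add: \<phi>_mod)
      qed
      have "\<phi> (H h) Y = \<phi> (H h - Suc p) (Y div K ^ Suc p) + \<phi> p Y"
        using \<phi>_split [OF dg(1), of "H h - Suc p"] Hp by simp
      moreover have "\<phi> (H h) (Y + 1) = \<phi> (H h - Suc p) (Y div K ^ Suc p) + \<phi> p (Y + 1)"
        using \<phi>_split [OF dg'(1), of "H h - Suc p"] Hp dg'(2) by simp
      ultimately have "A h w i = - \<phi> p Y + \<phi> p (Y + 1)"
        unfolding A_def Y1 Y_def [symmetric] by (simp only: group_add_normalize)
      also have "\<phi> p Y = \<phi> p (nat (?v mod int K ^ p))" by (rule md) (rule Yv)
      also have "\<phi> p (Y + 1) = \<phi> p (nat ((?v + 1) mod int K ^ p))" by (rule md) (simp add: Yv)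
      finally show "A h w i = - \<phi> p (nat (?v mod int K ^ p)) + \<phi> p (nat ((?v + 1) mod int K ^ p))" .
    qed
    have eq: "A h1 w1 i = A h2 w2 i" if "i < l" "i \<noteq> i0" for i
    proof -
      have "int i - int i0 \<in> J" using that by (auto simp: J_def)
      then obtain p where "p < q" "digit_stable (int K) (int d) p (int u + (int i - int i0) * int R)"
        using R(2) by blast
      then show ?thesis using main [OF W1] main [OF W2] that(1) by metis
    qed
    have "\<Gamma> (\<lambda>i. - A h1 w1 i + A h2 w2 i)"
      using main [OF W1] main [OF W2] by (intro \<Gamma>_add \<Gamma>_uminus) auto
    then have "\<Gamma> (at_coord i0 (- A h1 w1 i0 + A h2 w2 i0))"
      by (rule \<Gamma>_cong) (use eq in \<open>auto simp: at_coord_def\<close>)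
    then show "- (- \<phi> (h1 + q) (w1 * K ^ q + u) + \<phi> (h1 + q) (w1 * K ^ q + u + 1))
    + (- \<phi> (h2 + q) (w2 * K ^ q + u) + \<phi> (h2 + q) (w2 * K ^ q + u + 1)) \<in> N i0"
      using main [OF W1] main [OF W2] by (simp add: N_def)
  qed
qed

text \<open>Modulo \<open>N i0\<close> every increment of n multiplies by one and the same c in G.
  So n enters only through \<open>npow n c\<close>, and the exponent D kills multiples of D.\<close>

lemma \<phi>_cong_mod:
  assumes "i0 < l" "n < K ^ h" "n' < K ^ h" "n mod D = n' mod D"
  shows "- \<phi> h n + \<phi> h n' \<in> N i0"
proof -
  interpret normal_subgroup_in G "N i0" by (rule N_normal [OF assms(1)])
  write eqv (infix "\<approx>" 50)
  define \<delta> where "\<delta> h n = - \<phi> h n + \<phi> h (n + 1)" for h n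
  have \<phi>_step: "\<phi> h (n + 1) = \<phi> h n + \<delta> h n" for h n
    by (simp add: \<delta>_def)
  have \<delta>_G: "\<delta> h n \<in> G" for h n
    by (simp add: \<delta>_def add_in_G uminus_in_G)
  obtain q where q0: "\<forall>u h1 w1 h2 w2. w1 * K ^ q + u + 1 < K ^ (h1 + q) \<longrightarrow> w2 * K ^ q + u + 1 < K ^ (h2 + q) \<longrightarrow>
    - \<delta> (h1 + q) (w1 * K ^ q + u) + \<delta> (h2 + q) (w2 * K ^ q + u) \<in> N i0"
    using increment_local [OF assms(1)] unfolding \<delta>_def by (elim exE)
  have q: "\<delta> (h1 + q) (w1 * K ^ q + u) \<approx> \<delta> (h2 + q) (w2 * K ^ q + u)"
    if "w1 * K ^ q + u + 1 < K ^ (h1 + q)" "w2 * K ^ q + u + 1 < K ^ (h2 + q)" for u h1 w1 h2 w2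
    unfolding eqv_def using q0 [rule_format, OF that] .
  \<comment> \<open>\<open>E m\<close> is the word of m digits d, which can be appended to any word
    without effect.\<close>
  define E where "E = rec_nat 0 (\<lambda>_ x. x * K + d)"
  have E_less: "E m < K ^ m" for m
  proof (induction m)
    case (Suc m)
    have "E (Suc m) < (E m + 1) * K" using d_less by (simp add: E_def)
    also have "\<dots> \<le> K ^ m * K" using Suc by (intro mult_right_mono) auto
    finally show ?case by (simp add: mult.commute)
  qed (simp add: E_def)
  have E: "\<phi> (h + m) (w * K ^ m + E m) = \<phi> h w" for h m w
  proof (induction m)
    case (Suc m)
    have "w * K ^ Suc m + E (Suc m) = (w * K ^ m + E m) * K + d"
      by (simp add: E_def algebra_simps)
    then show ?case using \<phi>_append_d [of "h + m" "w * K ^ m + E m"] Suc by simp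
  qed (simp add: E_def)
  have le: "w * K ^ q + y + 1 < K ^ (h + q)" if "w < K ^ h" "y + 1 < K ^ q" for h w y
  proof -
    have "w * K ^ q + y + 1 < (w + 1) * K ^ q" using that by simp
    also have "\<dots> \<le> K ^ h * K ^ q" using that by (intro mult_right_mono) auto
    finally show ?thesis by (simp add: power_add)
  qed
  \<comment> \<open>Modulo N the increments in the last q digits do not see the prefix w, so summing
    them leaves a left factor that is independent of y.\<close>
  have tele: "\<phi> (h + q) (w * K ^ q + y) \<approx> (\<phi> (h + q) (w * K ^ q) - \<phi> q 0) + \<phi> q y"
    if "w < K ^ h" "y < K ^ q" for h w y
    using that(2)
  proof (induction y)
    case (Suc y)
    have "\<phi> (h + q) (w * K ^ q + Suc y) = \<phi> (h + q) (w * K ^ q + y) + \<delta> (h + q) (w * K ^ q + y)"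
      using \<phi>_step [of "h + q" "w * K ^ q + y"] by simp
    also have "\<dots> \<approx> \<phi> (h + q) (w * K ^ q + y) + \<delta> (0 + q) (0 * K ^ q + y)"
      by (intro eqv_add_left q le that) (use Suc.prems in auto)
    also have "\<dots> \<approx> ((\<phi> (h + q) (w * K ^ q) - \<phi> q 0) + \<phi> q y) + \<delta> (0 + q) (0 * K ^ q + y)"
      using Suc by (intro eqv_add_right \<delta>_G) auto
    also have "\<dots> = (\<phi> (h + q) (w * K ^ q) - \<phi> q 0) + \<phi> q (Suc y)"
      using \<phi>_step [of q y] by (simp add: add.assoc)
    finally show ?case .
  qed simp
  \<comment> \<open>Evaluation at \<open>y = E q\<close> identifies that factor as
    \<open>\<phi> h w\<close>. Modulo N, concatenation with q digits is thus multiplicative even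
    without a separating d.\<close>
  have split: "\<phi> (h + q) (w * K ^ q + y) \<approx> \<phi> h w + \<phi> q y"
    if "w < K ^ h" "y < K ^ q" for h w y
  proof -
    have "\<phi> q (E q) = 0" using E [of 0 q 0] by (simp only: add_0_left mult_zero_left \<phi>_0)
    then have "\<phi> h w \<approx> \<phi> (h + q) (w * K ^ q) - \<phi> q 0"
      using tele [OF that(1) E_less] by (simp only: E add_0_right)
    then have "\<phi> (h + q) (w * K ^ q) - \<phi> q 0 + \<phi> q y \<approx> \<phi> h w + \<phi> q y"
      by (intro eqv_add_right eqv_sym [OF \<open>\<phi> h w \<approx> _\<close>]) simp
    with tele [OF that] show ?thesis by (rule eqv_trans)
  qed
  \<comment> \<open>Passing from n to n + 1 is a carry out of q appended digits, that is, an
    increment of \<open>n * K ^ q + u\<close> whose low digits u are always the same.\<close>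
  define u where "u = K ^ q - 1"
  have u: "u + 1 = K ^ q" "u < K ^ q" by (simp_all add: u_def)
  \<comment> \<open>Length 1 + q in the middle term, since u + 1 = \<open>K ^ q\<close> no longer
    fits into q digits.\<close>
  define c where "c = \<phi> q u + \<delta> (1 + q) (0 * K ^ q + u) - \<phi> q 0"
  have cG: "c \<in> G"
    unfolding c_def diff_conv_add_uminus by (intro add_in_G \<delta>_G uminus_in_G) auto
  have inc: "\<phi> h (n + 1) \<approx> \<phi> h n + c" if n: "n + 1 < K ^ h" for h n
  proof -
    have b1: "n * K ^ q + u + 1 < K ^ (h + q)"
    proof -
      have "n * K ^ q + u + 1 = (n + 1) * K ^ q" using u by simp
      also have "\<dots> < K ^ h * K ^ q" using n by (intro mult_strict_right_mono) auto
      finally show ?thesis by (simp add: power_add)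
    qed
    have b2: "0 * K ^ q + u + 1 < K ^ (1 + q)" using K_ge_2 u by simp
    have "\<phi> h (n + 1) + \<phi> q 0 \<approx> \<phi> (h + q) ((n + 1) * K ^ q + 0)"
      by (intro eqv_sym [OF split]) (use n in auto)
    also have "(n + 1) * K ^ q + 0 = (n * K ^ q + u) + 1" using u by simp
    also have "\<phi> (h + q) (n * K ^ q + u + 1) = \<phi> (h + q) (n * K ^ q + u) + \<delta> (h + q) (n * K ^ q + u)"
      by (rule \<phi>_step)
    also have "\<dots> \<approx> \<phi> (h + q) (n * K ^ q + u) + \<delta> (1 + q) (0 * K ^ q + u)"
      by (intro eqv_add_left q b1 b2)
    also have "\<dots> \<approx> (\<phi> h n + \<phi> q u) + \<delta> (1 + q) (0 * K ^ q + u)"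
      by (intro eqv_add_right split \<delta>_G) (use n u in auto)
    finally have "\<phi> h (n + 1) + \<phi> q 0 + - \<phi> q 0
        \<approx> (\<phi> h n + \<phi> q u) + \<delta> (1 + q) (0 * K ^ q + u) + - \<phi> q 0"
      by (intro eqv_add_right uminus_in_G) auto
    then show ?thesis by (simp only: c_def group_add_normalize)
  qed
  have pw: "\<phi> h n \<approx> \<phi> h 0 + npow n c" if "n < K ^ h" for h n
    using that
  proof (induction n)
    case (Suc n)
    have "\<phi> h (Suc n) \<approx> \<phi> h n + c" using inc [of n h] Suc.prems by simp
    also have "\<dots> \<approx> (\<phi> h 0 + npow n c) + c" using Suc by (intro eqv_add_right cG) auto
    also have "\<dots> = \<phi> h 0 + npow (Suc n) c" by (simp add: add.assoc npow_commute)
    finally show ?case .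
  qed simp
  have "npow n c = npow n' c" by (rule npow_cong_mod [OF npow_D [OF cG] assms(4)])
  then have "\<phi> h 0 + npow n c \<approx> \<phi> h n'" using eqv_sym [OF pw [OF assms(3)]] by simp
  with pw [OF assms(2)] have "\<phi> h n \<approx> \<phi> h n'" by (rule eqv_trans)
  then show ?thesis by (simp add: eqv_def)
qed

text \<open>A single group for all coordinates, so that resampling gives all l terms the same
  distribution.\<close>

definition N_all :: "'g set" where
  "N_all = (\<Inter>i<l. N i)"

lemma N_all_subset_G:
  assumes "l > 0"
  shows "N_all \<subseteq> G"
proof
  fix g assume "g \<in> N_all"
  then have "\<Gamma> (at_coord 0 g)" using assms by (auto simp: N_all_def N_def)
  from \<Gamma>_in_G [OF this assms] show "g \<in> G" by (simp add: at_coord_def)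
qed

lemma finite_N_all: "l > 0 \<Longrightarrow> finite N_all"
  by (rule finite_subset [OF N_all_subset_G]) (use finite_\<phi> in \<open>simp_all add: G_def\<close>)

lemma N_all_normal: "normal_subgroup_in G N_all"
proof
  show "x + y \<in> N_all" if "x \<in> N_all" "y \<in> N_all" for x y
    using that normal_subgroup_in.add_N [OF N_normal] by (auto simp: N_all_def)
  show "- x \<in> N_all" if "x \<in> N_all" for x
    using that normal_subgroup_in.uminus_N [OF N_normal] by (auto simp: N_all_def)
  show "x + g - x \<in> N_all" if "x \<in> G" "g \<in> N_all" for x g
    using that normal_subgroup_in.conj_N [OF N_normal] by (auto simp: N_all_def)
  show "0 \<in> N_all" using normal_subgroup_in.zero_N [OF N_normal] by (auto simp: N_all_def)
qed (auto intro: add_in_G uminus_in_G)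

lemma \<phi>_cong_mod_N_all:
  assumes "n < K ^ h" "n' < K ^ h" "n mod D = n' mod D"
  shows "- \<phi> h n + \<phi> h n' \<in> N_all"
  using \<phi>_cong_mod [OF _ assms] by (auto simp: N_all_def)

lemma \<Gamma>_N_all:
  assumes "\<And>i. i < l \<Longrightarrow> \<gamma> i \<in> N_all"
  shows "\<Gamma> \<gamma>"
proof -
  have "\<Gamma> (\<lambda>i. if i < j then \<gamma> i else 0)" if "j \<le> l" for j
    using that
  proof (induction j)
    case 0
    then show ?case using \<Gamma>_diag [OF zero_in_G] by simp
  next
    case (Suc j)
    have "\<Gamma> (\<lambda>i. (if i < j then \<gamma> i else 0) + at_coord j (\<gamma> j) i)"
      using Suc assms [of j] by (intro \<Gamma>_add) (auto simp: N_all_def N_def)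
    then show ?case by (rule \<Gamma>_cong) (auto simp: at_coord_def)
  qed
  from this [of l] show ?thesis by (rule \<Gamma>_cong) auto
qed

text \<open>There are finitely many tuples, and padding makes their words equally long. They can
  then be exchanged inside a block of fixed size.\<close>

lemma common_length:
  assumes "l > 0"
  shows "\<exists>h. \<forall>\<gamma> \<in> {..<l} \<rightarrow>\<^sub>E N_all. ap_tuple h \<gamma>"
proof -
  let ?P = "{..<l} \<rightarrow>\<^sub>E N_all"
  have fin: "finite ?P" using finite_N_all [OF assms] by (intro finite_PiE) auto
  have "\<exists>h. ap_tuple h \<gamma>" if "\<gamma> \<in> ?P" for \<gamma>
    using \<Gamma>_N_all [of \<gamma>] PiE_mem [OF that] by (auto simp: \<Gamma>_def)
  then obtain h where h: "\<And>\<gamma>. \<gamma> \<in> ?P \<Longrightarrow> ap_tuple (h \<gamma>) \<gamma>" by metis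
  have "ap_tuple (sum h ?P) \<gamma>" if "\<gamma> \<in> ?P" for \<gamma>
    using member_le_sum [of \<gamma> ?P h] that fin h by (intro ap_tuple_mono [OF _ h]) auto
  then show ?thesis by blast
qed

end

subsection \<open>Automata with a resetting digit\<close>

text \<open>Exactly h digits of n are read, the most significant first, with leading zeros included
  and digits above place h ignored.\<close>

primrec act :: "('q \<Rightarrow> nat \<Rightarrow> 'q) \<Rightarrow> nat \<Rightarrow> nat \<Rightarrow> nat \<Rightarrow> 'q \<Rightarrow> 'q" where
  "act \<delta> K 0 n s = s"
| "act \<delta> K (Suc h) n s = \<delta> (act \<delta> K h (n div K) s) (n mod K)"

lemma act_add: "act \<delta> K (h1 + h2) n s = act \<delta> K h2 n (act \<delta> K h1 (n div K ^ h2) s)"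
  by (induction h2 arbitrary: n) (simp_all add: div_mult2_eq)

lemma act_mod: "act \<delta> K h (n mod K ^ h) s = act \<delta> K h n s"
proof (induction h arbitrary: n)
  case (Suc h)
  have 1: "n mod K ^ Suc h div K = n div K mod K ^ h"
    by (cases "K = 0") (simp_all add: mod_mult2_eq)
  have 2: "n mod K ^ Suc h mod K = n mod K" by (simp add: mod_mult2_eq)
  show ?case using Suc by (simp only: act.simps 1 2)
qed simp

lemma act_closed:
  assumes "\<And>s a. s \<in> S \<Longrightarrow> a < K \<Longrightarrow> \<delta> s a \<in> S" "K > 0" "s \<in> S"
  shows "act \<delta> K h n s \<in> S"
  using assms by (induction h arbitrary: n) auto

section \<open>Bijections as an additive group\<close>

typedef 'a bijection = "{f :: 'a \<Rightarrow> 'a. bij f}"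
  morphisms app Bijection
  by (intro exI [of _ id]) simp

setup_lifting type_definition_bijection

instantiation bijection :: (type) group_add
begin

lift_definition zero_bijection :: "'a bijection" is id by simp
text \<open>The left summand acts first, so that sums follow the order in which digits are
  read.\<close>

lift_definition plus_bijection :: "'a bijection \<Rightarrow> 'a bijection \<Rightarrow> 'a bijection" is "\<lambda>f g. g \<circ> f"
  by (rule bij_comp)
lift_definition uminus_bijection :: "'a bijection \<Rightarrow> 'a bijection" is inv
  by (rule bij_imp_bij_inv)
lift_definition minus_bijection :: "'a bijection \<Rightarrow> 'a bijection \<Rightarrow> 'a bijection" is "\<lambda>f g. inv g \<circ> f"
  by (intro bij_comp bij_imp_bij_inv)

instance
proof
  fix a b c :: "'a bijection"
  show "a + b + c = a + (b + c)" by transfer (simp add: comp_assoc)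
  show "0 + a = a" by transfer simp
  show "a + 0 = a" by transfer simp
  show "- a + a = 0" by transfer (simp add: bij_def surj_iff)
  show "a + - b = a - b" by transfer simp
qed

end

lemma app_plus: "app (p + q) x = app q (app p x)"
  by transfer simp

text \<open>The last assumption is the form in which minimal rank is used: once d has been read, no
  word followed by d can merge two states.\<close>

locale reset_automaton =
  fixes K d :: nat and \<delta> :: "'q \<Rightarrow> nat \<Rightarrow> 'q" and S :: "'q set"
  assumes K_ge_2: "2 \<le> K" and d_less: "d < K" and finite_S: "finite S"
    and \<delta>_closed: "s \<in> S \<Longrightarrow> a < K \<Longrightarrow> \<delta> s a \<in> S"
    and idem: "s \<in> S \<Longrightarrow> \<delta> (\<delta> s d) d = \<delta> s d"
    and inj: "inj_on (\<lambda>x. \<delta> (act \<delta> K h n x) d) ((\<lambda>s. \<delta> s d) ` S)"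
begin

definition X :: "'q set" where
  "X = (\<lambda>s. \<delta> s d) ` S"

lemma finite_X: "finite X"
  by (simp add: X_def finite_S)

lemma X_subset: "X \<subseteq> S"
  using \<delta>_closed d_less by (auto simp: X_def)

lemma \<delta>_d_in_X: "s \<in> S \<Longrightarrow> \<delta> s d \<in> X"
  by (simp add: X_def)

lemma act_in_S: "s \<in> S \<Longrightarrow> act \<delta> K h n s \<in> S"
  using K_ge_2 by (intro act_closed \<delta>_closed) auto

lemma \<delta>_d_X: "x \<in> X \<Longrightarrow> \<delta> x d = x"
  by (auto simp: X_def idem)

text \<open>Extended by the identity off X, because the group consists of bijections of the whole
  type.\<close>

definition \<phi>_fun :: "nat \<Rightarrow> nat \<Rightarrow> 'q \<Rightarrow> 'q" where
  "\<phi>_fun h n x = (if x \<in> X then \<delta> (act \<delta> K h n x) d else x)"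

definition \<phi> :: "nat \<Rightarrow> nat \<Rightarrow> 'q bijection" where
  "\<phi> h n = Bijection (\<phi>_fun h n)"

lemma \<phi>_fun_permutes: "\<phi>_fun h n permutes X"
proof (rule bij_imp_permutes)
  have "inj_on (\<phi>_fun h n) X"
    using inj [of h n] by (simp add: X_def \<phi>_fun_def inj_on_def)
  moreover have "\<phi>_fun h n ` X \<subseteq> X"
    using X_subset by (auto simp: \<phi>_fun_def intro!: \<delta>_d_in_X act_in_S)
  ultimately show "bij_betw (\<phi>_fun h n) X X"
    using endo_inj_surj [OF finite_X] by (simp add: bij_betw_def)
qed (simp add: \<phi>_fun_def)

lemma app_\<phi>_fun: "app (\<phi> h n) = \<phi>_fun h n"
  unfolding \<phi>_def by (rule Bijection_inverse) (simp add: permutes_bij [OF \<phi>_fun_permutes])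

lemma app_\<phi>: "x \<in> X \<Longrightarrow> app (\<phi> h n) x = \<delta> (act \<delta> K h n x) d"
  by (simp add: app_\<phi>_fun \<phi>_fun_def)

lemma app_\<phi>_in_X: "x \<in> X \<Longrightarrow> app (\<phi> h n) x \<in> X"
  by (simp add: app_\<phi>_fun permutes_in_image [OF \<phi>_fun_permutes])

lemma bijection_eqI: "(\<And>x. app p x = app q x) \<Longrightarrow> p = q"
  by (metis app_inject ext)

lemma finite_range_\<phi>: "finite {\<phi> h n |h n. True}"
proof (rule finite_subset)
  show "{\<phi> h n |h n. True} \<subseteq> Bijection ` {p. p permutes X}"
    using \<phi>_fun_permutes by (auto simp: \<phi>_def)
qed (simp add: finite_permutations finite_X)

lemma \<phi>_length_0: "\<phi> 0 n = 0"
  by (rule bijection_eqI) (simp add: app_\<phi>_fun \<phi>_fun_def \<delta>_d_X zero_bijection.rep_eq)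

lemma \<phi>_mod_power: "\<phi> h (n mod K ^ h) = \<phi> h n"
  by (rule bijection_eqI) (simp add: app_\<phi>_fun \<phi>_fun_def act_mod)

lemma \<phi>_split_at_d:
  assumes "(n div K ^ h2) mod K = d"
  shows "\<phi> (h1 + Suc h2) n = \<phi> h1 (n div K ^ Suc h2) + \<phi> h2 n"
proof (rule bijection_eqI)
  fix x
  have *: "act \<delta> K (h1 + Suc h2) n x = act \<delta> K h2 n (\<delta> (act \<delta> K h1 (n div K ^ Suc h2) x) d)"
    using act_add [of \<delta> K "Suc h1" h2 n x] assms by (simp add: div_mult2_eq power_Suc2 del: power_Suc)
  show "app (\<phi> (h1 + Suc h2) n) x = app (\<phi> h1 (n div K ^ Suc h2) + \<phi> h2 n) x"
  proof (cases "x \<in> X")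
    case True
    then show ?thesis
      using app_\<phi>_in_X [OF True, of h1 "n div K ^ Suc h2"] by (simp only: app_plus app_\<phi> *)
  next
    case False
    then show ?thesis by (simp add: app_plus app_\<phi>_fun \<phi>_fun_def)
  qed
qed

lemma block_group_exists: "\<exists>D. block_group K d D \<phi>"
proof -
  define G where "G = {\<phi> h n |h n. True}"
  have "\<exists>D>0. \<forall>g\<in>G. npow D g = 0"
  proof (rule finite_exponent)
    show "0 \<in> G" unfolding G_def using \<phi>_length_0 [of 0] by force
    show "x + y \<in> G" if "x \<in> G" "y \<in> G" for x y
    proof -
      obtain h1 n1 h2 n2 where xy: "x = \<phi> h1 n1" "y = \<phi> h2 n2" using \<open>x \<in> G\<close> \<open>y \<in> G\<close> by (auto simp: G_def)
      define n where "n = n2 mod K ^ h2 + K ^ h2 * (n1 * K + d)"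
      have K: "K > 0" using K_ge_2 by simp
      have 1: "n div K ^ h2 = n1 * K + d" unfolding n_def using K by (simp add: div_mult_self4)
      have 2: "n mod K ^ h2 = n2 mod K ^ h2" unfolding n_def by simp
      have "\<phi> (h1 + Suc h2) n = \<phi> h1 (n div K ^ Suc h2) + \<phi> h2 n"
        by (rule \<phi>_split_at_d) (use 1 d_less in simp)
      moreover have "n div K ^ Suc h2 = n1" using 1 d_less by (simp add: power_Suc2 div_mult2_eq del: power_Suc)
      ultimately have "x + y = \<phi> (h1 + Suc h2) n" using xy 2 \<phi>_mod_power by metis
      then show ?thesis by (auto simp: G_def)
    qed
  qed (use finite_range_\<phi> in \<open>simp add: G_def\<close>)
  then obtain D where D: "D > 0" "\<And>g. g \<in> G \<Longrightarrow> npow D g = 0" by blast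
  have exp: "npow D (\<phi> h n) = 0" for h n
    by (rule D(2)) (auto simp: G_def)
  have "block_group K d D \<phi>"
    by unfold_locales
      (use K_ge_2 d_less finite_range_\<phi> \<phi>_length_0 \<phi>_mod_power \<phi>_split_at_d D(1) exp in \<open>auto simp del: power_Suc\<close>)
  then show ?thesis ..
qed

end

subsection \<open>Resampling a block\<close>

text \<open>Replacing the power by its tangent makes the inequality additive over fibres.\<close>

lemma tangent_power_le:
  fixes a x :: real
  assumes "a \<ge> 0" "x \<ge> 0" "l \<ge> 1"
  shows "a ^ l + real l * a ^ (l - 1) * (x - a) \<le> x ^ l"
proof -
  have "a ^ Suc n + real (Suc n) * a ^ n * (x - a) \<le> x ^ Suc n" for n
  proof (induction n)
    case (Suc n)
    have "x ^ Suc (Suc n) - (a ^ Suc (Suc n) + real (Suc (Suc n)) * a ^ Suc n * (x - a))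
        = x * (x ^ Suc n - (a ^ Suc n + real (Suc n) * a ^ n * (x - a))) + real (Suc n) * a ^ n * (x - a)\<^sup>2"
      by (simp add: algebra_simps power2_eq_square)
    moreover have "0 \<le> x * (x ^ Suc n - (a ^ Suc n + real (Suc n) * a ^ n * (x - a)))"
      using Suc.IH assms by (intro mult_nonneg_nonneg) auto
    moreover have "0 \<le> real (Suc n) * a ^ n * (x - a)\<^sup>2" using assms by simp
    ultimately show ?case by linarith
  qed simp
  from this [of "l - 1"] show ?thesis using assms(3) by simp
qed

text \<open>\<open>l_le_K\<close> bounds the carry produced by adding i m, i < l, by a single digit;
  \<open>\<delta>_s0\<close> makes leading zeros harmless. For the set A, \<open>F\<close> will be
  the indicator of output 1.\<close>

locale ap_counting =
  reset_automaton K d \<delta> S + bg: block_group K d l D "reset_automaton.\<phi> K d \<delta> S"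
  for K d :: nat and \<delta> :: "'q \<Rightarrow> nat \<Rightarrow> 'q" and S and l D :: nat +
  fixes s0 :: 'q and F :: "'q \<Rightarrow> real"
  assumes l_ge_2: "l \<ge> 2" and l_le_K: "l \<le> K" and s0_in_S: "s0 \<in> S" and \<delta>_s0: "\<delta> s0 0 = s0"
    and F_nonneg: "F s \<ge> 0" and F_le_1: "F s \<le> 1"
begin

text \<open>Since n < K^n, reading n digits suffices, and more leading zeros would change
  nothing.\<close>

definition st :: "nat \<Rightarrow> 'q" where
  "st n = act \<delta> K n n s0"

definition f :: "nat \<Rightarrow> real" where
  "f n = F (st n)"

lemma less_power_K: "n < K ^ n"
proof -
  have "n < 2 ^ n" by (rule less_exp)
  also have "\<dots> \<le> K ^ n" using K_ge_2 by (intro power_mono) auto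
  finally show ?thesis .
qed

lemma act_zeros: "act \<delta> K h 0 s0 = s0"
  by (induction h) (simp_all add: \<delta>_s0)

lemma st_eq:
  assumes "n < K ^ h"
  shows "st n = act \<delta> K h n s0"
proof -
  have *: "act \<delta> K (j + h') n s0 = act \<delta> K h' n s0" if "n < K ^ h'" for j h'
    using that by (simp add: act_add act_zeros)
  show ?thesis
    using * [OF assms, where j = n] * [OF less_power_K, where j = h] by (simp add: st_def add.commute)
qed

lemma st_split: "st n = act \<delta> K h n (st (n div K ^ h))"
proof -
  have "n div K ^ h < K ^ n"
    using less_power_K [of n] div_le_dividend [of n "K ^ h"] by linarith
  moreover have "n < K ^ (n + h)"
    using less_power_K [of n] by (rule less_le_trans) (use K_ge_2 in \<open>simp add: power_add\<close>)
  ultimately show ?thesis by (simp add: st_eq act_add)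
qed

lemma st_in_S: "st n \<in> S"
  unfolding st_def by (intro act_in_S s0_in_S)

lemma st_append: "a < K \<Longrightarrow> st (n * K + a) = \<delta> (st n) a"
  using st_split [of "n * K + a" 1] by simp

lemma st_append_d: "\<delta> (st n) d \<in> X"
  by (intro \<delta>_d_in_X st_in_S)

lemma f_bounds: "0 \<le> f n" "f n \<le> 1"
  by (simp_all add: f_def F_nonneg F_le_1)

lemma digits_at_d:
  assumes "v < K ^ h"
  shows "\<delta> (st (a * K ^ Suc h + d * K ^ h + v)) d = app (\<phi> h v) (\<delta> (st a) d)"
proof -
  let ?n = "a * K ^ Suc h + d * K ^ h + v"
  have n: "?n = v + K ^ h * (a * K + d)" by (simp add: algebra_simps)
  have 1: "?n div K ^ h = a * K + d" unfolding n using assms by (simp add: div_mult_self4)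
  have 2: "?n mod K ^ h = v" unfolding n using assms by simp
  have "st ?n = act \<delta> K h ?n (\<delta> (st a) d)"
    using st_split [of ?n h] 1 d_less by (simp only: st_append)
  then have "st ?n = act \<delta> K h v (\<delta> (st a) d)" using 2 act_mod [of \<delta> K h ?n] by metis
  then show ?thesis by (simp add: app_\<phi> st_append_d)
qed

section \<open>Special blocks and their surroundings\<close>

definition h0 :: nat where
  "h0 = (SOME h. \<forall>\<gamma>\<in>{..<l} \<rightarrow>\<^sub>E bg.N_all. bg.ap_tuple h \<gamma>)"

definition NN :: "(nat \<Rightarrow> 'q bijection) set" where
  "NN = {..<l} \<rightarrow>\<^sub>E bg.N_all"

definition block :: "(nat \<Rightarrow> 'q bijection) \<Rightarrow> nat \<times> nat" where
  "block \<gamma> = (SOME (w, t). D dvd t \<and> w + (l - 1) * t < K ^ h0 \<and> (\<forall>i<l. \<gamma> i = \<phi> h0 (w + i * t)))"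

lemma block:
  assumes "\<gamma> \<in> NN"
  shows "D dvd snd (block \<gamma>)" "fst (block \<gamma>) + (l - 1) * snd (block \<gamma>) < K ^ h0"
    "\<And>i. i < l \<Longrightarrow> \<gamma> i = \<phi> h0 (fst (block \<gamma>) + i * snd (block \<gamma>))"
proof -
  have "\<exists>h. \<forall>\<gamma>\<in>{..<l} \<rightarrow>\<^sub>E bg.N_all. bg.ap_tuple h \<gamma>"
    by (rule bg.common_length) (use l_ge_2 in simp)
  then have "\<forall>\<gamma>\<in>{..<l} \<rightarrow>\<^sub>E bg.N_all. bg.ap_tuple h0 \<gamma>"
    unfolding h0_def by (rule someI_ex)
  then have "bg.ap_tuple h0 \<gamma>" using assms by (simp add: NN_def)
  then have "\<exists>p. case p of (w, t) \<Rightarrow> D dvd t \<and> w + (l - 1) * t < K ^ h0 \<and> (\<forall>i<l. \<gamma> i = \<phi> h0 (w + i * t))"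
    unfolding bg.ap_tuple_def by auto
  then have "case block \<gamma> of (w, t) \<Rightarrow> D dvd t \<and> w + (l - 1) * t < K ^ h0 \<and> (\<forall>i<l. \<gamma> i = \<phi> h0 (w + i * t))"
    unfolding block_def by (rule someI_ex)
  then show "D dvd snd (block \<gamma>)" "fst (block \<gamma>) + (l - 1) * snd (block \<gamma>) < K ^ h0"
    "\<And>i. i < l \<Longrightarrow> \<gamma> i = \<phi> h0 (fst (block \<gamma>) + i * snd (block \<gamma>))"
    by (auto simp: case_prod_beta)
qed

text \<open>A block has h0 + 3 digits: a cut d, the h0 digits of the chosen word, another cut d, and
  a zero that receives the carry from below.\<close>

definition Q :: nat where
  "Q = K ^ (h0 + 3)"

definition \<beta> :: "(nat \<Rightarrow> 'q bijection) \<Rightarrow> nat" where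
  "\<beta> \<gamma> = d * K ^ (h0 + 2) + fst (block \<gamma>) * K ^ 2 + d * K"

definition \<tau> :: "(nat \<Rightarrow> 'q bijection) \<Rightarrow> nat" where
  "\<tau> \<gamma> = snd (block \<gamma>) * K ^ 2"

text \<open>The slack \<open>m + 1\<close> and \<open>u + 1\<close> leaves room for carries from later digits.\<close>

definition good_upper :: "nat \<Rightarrow> nat \<Rightarrow> bool" where
  "good_upper n m \<longleftrightarrow> D dvd m \<and>
     (\<exists>U h u. n = U * K ^ Suc h + d * K ^ h + u \<and> u + 1 + (l - 1) * (m + 1) \<le> K ^ h)"

text \<open>The last c + 1 digits of m vanish, so n + i m shares with n the cut d at place c and
  everything below it. Above the cut the step is m', a multiple of D.\<close>

definition good_lower :: "nat \<Rightarrow> nat \<Rightarrow> nat \<Rightarrow> bool" where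
  "good_lower p n m \<longleftrightarrow> n < Q ^ p \<and> m < Q ^ p \<and>
     (\<exists>c m'. Suc c \<le> (h0 + 3) * p \<and> m = K ^ Suc c * m' \<and> D dvd m' \<and> (n div K ^ c) mod K = d)"

text \<open>All terms share the part above the cut in \<open>na\<close>, which determines a starting
  state, and the part below the cut in \<open>nc\<close>, which is absorbed into F'. Only the three
  permutations in between depend on i. The outer two agree modulo \<open>N_all\<close> for all i
  because the steps there are divisible by D; the middle one is the free \<gamma> i.\<close>

lemma resampling_form:
  assumes "good_upper na ma" "good_lower p nc mc"
  shows "\<exists>F' \<chi> \<psi>. (\<forall>g. 0 \<le> F' g \<and> F' g \<le> (1::real)) \<and>
    (\<forall>i<l. \<chi> i \<in> bg.G \<and> \<psi> i \<in> bg.G \<and> - \<chi> i + \<chi> 0 \<in> bg.N_all \<and> - \<psi> i + \<psi> 0 \<in> bg.N_all) \<and>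
    (\<forall>\<gamma>\<in>NN. \<forall>i<l. f ((na * Q + \<beta> \<gamma>) * Q ^ p + nc + i * ((ma * Q + \<tau> \<gamma>) * Q ^ p + mc)) = F' (\<chi> i + \<gamma> i + \<psi> i))"
proof -
  obtain U h u where U: "D dvd ma" "na = U * K ^ Suc h + d * K ^ h + u" "u + 1 + (l - 1) * (ma + 1) \<le> K ^ h"
    using assms(1) by (auto simp: good_upper_def)
  obtain c m' where c: "nc < Q ^ p" "mc < Q ^ p" "Suc c \<le> (h0 + 3) * p" "mc = K ^ Suc c * m'" "D dvd m'"
      "(nc div K ^ c) mod K = d"
    using assms(2) by (auto simp: good_lower_def)
  have K0: "K > 0" using K_ge_2 by simp
  define P where "P = Q ^ p"
  define b where "b = (h0 + 3) * p"
  have P: "P = K ^ b" by (simp add: P_def b_def Q_def power_mult)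
  define x where "x = \<delta> (st U) d"
  have x: "x \<in> X" by (simp add: x_def st_append_d)
  define y where "y i = nc div K ^ Suc c + i * m'" for i
  define F' where "F' g = F (act \<delta> K c nc (app g x))" for g
  define \<chi> where "\<chi> i = \<phi> h (u + i * ma)" for i
  \<comment> \<open>b - c digits lie above place c when the spare digit at place b is counted with
    the lower part.\<close>
  define \<psi> where "\<psi> i = \<phi> (b - c) (y i)" for i
  have u: "u + i * ma < K ^ h" if "i < l" for i
  proof -
    have "u + (l - 1) * ma < K ^ h" using U(3) unfolding distrib_left by linarith
    then show ?thesis using bg.ap_bound that by blast
  qed
  have P0: "P > 0" using K0 by (simp add: P)
  \<comment> \<open>Since i < l \<le> K, the carry of the lower part fits into the spare
    digit.\<close>
  have Yc: "nc + i * mc < K * P" if "i < l" for i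
  proof -
    have "i * mc \<le> i * P" using c by (intro mult_left_mono) (auto simp: P_def)
    then have "nc + i * mc < (i + 1) * P" using c(1) unfolding P_def distrib_right by linarith
    also have "\<dots> \<le> K * P" using that l_le_K by (intro mult_right_mono) auto
    finally show ?thesis .
  qed
  have ydiv: "(nc + i * mc) div K ^ Suc c = y i" for i
    unfolding y_def c(4) mult.left_commute [of i] using K0 by (subst div_mult_self2) auto
  have KP: "K * P = K ^ (b - c) * K ^ Suc c"
    using c(3) by (simp add: P b_def flip: power_Suc power_add)
  have y: "y i < K ^ (b - c)" if "i < l" for i
    unfolding ydiv [symmetric] using Yc [OF that] by (simp add: KP less_mult_imp_div_less del: power_Suc)
  have main: "f ((na * Q + \<beta> \<gamma>) * P + nc + i * ((ma * Q + \<tau> \<gamma>) * P + mc)) = F' (\<chi> i + \<gamma> i + \<psi> i)"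
    if \<gamma>: "\<gamma> \<in> NN" and i: "i < l" for \<gamma> i
  proof -
    define w where "w = fst (block \<gamma>) + i * snd (block \<gamma>)"
    have w: "w < K ^ h0" "\<gamma> i = \<phi> h0 w"
      using block [OF \<gamma>] i bg.ap_bound unfolding w_def by blast+
    define Z where "Z = (na + i * ma) * K ^ Suc h0 + d * K ^ h0 + w"
    define Y where "Y = (na * Q + \<beta> \<gamma>) * P + nc + i * ((ma * Q + \<tau> \<gamma>) * P + mc)"
    have Y: "Y = (nc + i * mc) + (K * P) * (Z * K + d)"
      by (simp add: Y_def Z_def w_def Q_def \<beta>_def \<tau>_def power_add power2_eq_square power3_eq_cube algebra_simps)
    have "Y div (K * P) = Z * K + d"
      unfolding Y using Yc [OF i] K0 P0 by (subst div_mult_self2) auto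
    then have "st Y = act \<delta> K (Suc b) Y (\<delta> (st Z) d)"
      using st_split [of Y "Suc b"] st_append [OF d_less] by (simp add: P)
    also have "\<delta> (st Z) d = app (\<phi> h0 w) (\<delta> (st (na + i * ma)) d)"
      unfolding Z_def by (rule digits_at_d [OF w(1)])
    also have "na + i * ma = U * K ^ Suc h + d * K ^ h + (u + i * ma)" by (simp add: U(2))
    also have "\<delta> (st \<dots>) d = app (\<chi> i) x"
      unfolding x_def \<chi>_def by (rule digits_at_d [OF u [OF i]])
    also have "app (\<phi> h0 w) (app (\<chi> i) x) = app (\<chi> i + \<gamma> i) x"
      by (simp add: app_plus w(2))
    also have "act \<delta> K (Suc b) Y (app (\<chi> i + \<gamma> i) x)
      = act \<delta> K c nc (app (\<psi> i) (app (\<chi> i + \<gamma> i) x))"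
    proof -
      let ?x = "app (\<chi> i + \<gamma> i) x"
      have xX: "?x \<in> X" using x by (simp add: app_plus w(2) \<chi>_def app_\<phi>_in_X)
      have KPc: "K * P = K ^ c * (K * K ^ (b - c))" by (simp add: KP algebra_simps)
      have "Y = nc + K ^ c * (K * (i * m' + K ^ (b - c) * (Z * K + d)))"
        unfolding Y KPc c(4) by (simp add: algebra_simps)
      then have Yd: "Y div K ^ c = nc div K ^ c + K * (i * m' + K ^ (b - c) * (Z * K + d))" "Y mod K ^ c = nc mod K ^ c"
        using K0 by simp_all
      then have dg: "(Y div K ^ c) mod K = d" using c(6) by simp
      have "Y div K ^ Suc c = (nc + i * mc) div K ^ Suc c + K ^ (b - c) * (Z * K + d)"
      proof -
        have "Y = (nc + i * mc) + K ^ Suc c * (K ^ (b - c) * (Z * K + d))"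
          unfolding Y KP by (simp add: algebra_simps)
        then show ?thesis using K0 by (simp del: power_Suc)
      qed
      then have ym: "Y div K ^ Suc c mod K ^ (b - c) = y i"
        using y [OF i] by (simp add: ydiv del: power_Suc)
      have "Suc b = Suc (b - c) + c" using c(3) by (simp add: b_def)
      then have "act \<delta> K (Suc b) Y ?x = act \<delta> K c Y (act \<delta> K (Suc (b - c)) (Y div K ^ c) ?x)"
        by (simp only: act_add)
      also have "act \<delta> K (Suc (b - c)) (Y div K ^ c) ?x = \<delta> (act \<delta> K (b - c) (Y div K ^ Suc c) ?x) d"
        using dg by (simp add: div_mult2_eq power_Suc2 del: power_Suc)
      also have "\<dots> = app (\<phi> (b - c) (Y div K ^ Suc c)) ?x" using xX by (simp add: app_\<phi>)
      also have "\<phi> (b - c) (Y div K ^ Suc c) = \<psi> i" using ym \<phi>_mod_power unfolding \<psi>_def by metis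
      also have "act \<delta> K c Y (app (\<psi> i) ?x) = act \<delta> K c nc (app (\<psi> i) ?x)"
        using Yd(2) act_mod by metis
      finally show ?thesis .
    qed
    finally show ?thesis by (simp add: Y_def [symmetric] f_def F'_def app_plus)
  qed
  have cong: "- \<chi> i + \<chi> 0 \<in> bg.N_all" "- \<psi> i + \<psi> 0 \<in> bg.N_all" if "i < l" for i
  proof -
    have l0: "0 < l" using l_ge_2 by simp
    show "- \<chi> i + \<chi> 0 \<in> bg.N_all" unfolding \<chi>_def
      by (rule bg.\<phi>_cong_mod_N_all [OF u [OF that] u [OF l0]]) (use U(1) in \<open>auto simp: dvd_def mult.left_commute [of i]\<close>)
    show "- \<psi> i + \<psi> 0 \<in> bg.N_all" unfolding \<psi>_def
      by (rule bg.\<phi>_cong_mod_N_all [OF y [OF that] y [OF l0]]) (use c(5) in \<open>auto simp: y_def dvd_def mult.left_commute [of i]\<close>)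
  qed
  have mem: "\<chi> i \<in> bg.G" "\<psi> i \<in> bg.G" for i
    by (simp_all add: \<chi>_def \<psi>_def)
  have bounds: "0 \<le> F' g \<and> F' g \<le> 1" for g
    by (simp add: F'_def F_nonneg F_le_1)
  show ?thesis
    by (rule exI [of _ F'], rule exI [of _ \<chi>], rule exI [of _ \<psi>])
      (use bounds mem cong main in \<open>simp add: P_def\<close>)
qed

end

subsection \<open>Averaging over blocks\<close>

lemma card_avoid_digit:
  assumes "z < (Q::nat)"
  shows "finite {x. x < A * Q ^ r \<and> (\<forall>j<r. x div Q ^ j mod Q \<noteq> z)} \<and>
    card {x. x < A * Q ^ r \<and> (\<forall>j<r. x div Q ^ j mod Q \<noteq> z)} \<le> A * (Q - 1) ^ r"
proof (induction r)
  case 0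
  have "{x. x < A * Q ^ 0 \<and> (\<forall>j<0. x div Q ^ j mod Q \<noteq> z)} = {..<A}" by auto
  then show ?case by simp
next
  case (Suc r)
  let ?B = "\<lambda>r. {x. x < A * Q ^ r \<and> (\<forall>j<r. x div Q ^ j mod Q \<noteq> z)}"
  have sub: "?B (Suc r) \<subseteq> (\<lambda>(y, e). y * Q + e) ` (?B r \<times> ({..<Q} - {z}))"
  proof
    fix x assume x: "x \<in> ?B (Suc r)"
    have "x div Q ^ Suc j = x div Q div Q ^ j" for j by (simp add: div_mult2_eq)
    then have "x div Q \<in> ?B r"
      using x by (auto simp: less_mult_imp_div_less mult.assoc mult.commute [of Q] simp del: power_Suc simp flip: power_Suc2)
    moreover have "x mod Q \<in> {..<Q} - {z}" using x assms by (force dest: spec [of _ 0])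
    ultimately show "x \<in> (\<lambda>(y, e). y * Q + e) ` (?B r \<times> ({..<Q} - {z}))"
      by (intro image_eqI [of _ _ "(x div Q, x mod Q)"] SigmaI) simp
  qed
  have fin: "finite (?B r \<times> ({..<Q} - {z}))" using Suc by simp
  have "card (?B (Suc r)) \<le> card (?B r \<times> ({..<Q} - {z}))"
    using card_mono [OF finite_imageI [OF fin] sub] card_image_le [OF fin] by (rule order_trans)
  also have "\<dots> = card (?B r) * (Q - 1)" using assms by (simp add: card_cartesian_product)
  also have "\<dots> \<le> A * (Q - 1) ^ r * (Q - 1)" using Suc by (intro mult_right_mono) auto
  finally show ?case using finite_subset [OF sub finite_imageI [OF fin]] by (simp add: ac_simps)
qed

lemma sum_digit_split:
  fixes g :: "nat \<Rightarrow> 'a::comm_monoid_add"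
  shows "(\<Sum>n<A * P. g n) = (\<Sum>a<A. \<Sum>c<P. g (a * P + c))"
proof -
  have "sum g {m * P..<m * P + P} = (\<Sum>c<P. g (m * P + c))" for m
    using sum.shift_bounds_nat_ivl [of g 0 "m * P" P] by (simp add: add.commute atLeast0LessThan)
  then show ?thesis by (simp flip: sum.nat_group)
qed

context ap_counting
begin

text \<open>Excess of the product over the tangent of x^l at a. The subtracted part is affine in f
  n, so its sum over n sees only the global density, while sums of \<Delta> can still be estimated
  fibre by fibre.\<close>

definition \<Delta> :: "real \<Rightarrow> nat \<Rightarrow> nat \<Rightarrow> real" where
  "\<Delta> a n m = (\<Prod>i<l. f (n + i * m)) - (a ^ l + real l * a ^ (l - 1) * (f n - a))"

text \<open>The loss charged to each pair that cannot be resampled.\<close>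

lemma \<Delta>_ge:
  assumes "a \<ge> 0"
  shows "\<Delta> a n m \<ge> - 1"
proof -
  have "a ^ l + real l * a ^ (l - 1) * (f n - a) \<le> f n ^ l"
    using assms l_ge_2 f_bounds by (intro tangent_power_le) auto
  also have "\<dots> \<le> 1" using f_bounds by (intro power_le_one) auto
  finally show ?thesis using prod_nonneg [of "{..<l}" "\<lambda>i. f (n + i * m)"] f_bounds by (simp add: \<Delta>_def)
qed

lemma finite_NN: "finite NN"
  unfolding NN_def using bg.finite_N_all l_ge_2 by (intro finite_PiE) auto

text \<open>On a fibre \<gamma> runs through a full l-fold product, so the sum of products factors
  into l sums, all equal by \<open>sum_coset_eq\<close>. What remains is the tangent inequality at
  their common mean \<mu>.\<close>

lemma resampling_sum:
  assumes "good_upper na ma" "good_lower p nc mc" "a \<ge> 0"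
  shows "(\<Sum>\<gamma>\<in>NN. \<Delta> a ((na * Q + \<beta> \<gamma>) * Q ^ p + nc) ((ma * Q + \<tau> \<gamma>) * Q ^ p + mc)) \<ge> 0"
proof -
  interpret normal_subgroup_in bg.G bg.N_all by (rule bg.N_all_normal)
  obtain F' \<chi> \<psi> where F'_bounds: "\<forall>g. 0 \<le> F' g \<and> F' g \<le> (1::real)"
    and memG: "\<forall>i<l. \<chi> i \<in> bg.G \<and> \<psi> i \<in> bg.G \<and> - \<chi> i + \<chi> 0 \<in> bg.N_all \<and> - \<psi> i + \<psi> 0 \<in> bg.N_all"
    and f_form: "\<forall>\<gamma>\<in>NN. \<forall>i<l.
      f ((na * Q + \<beta> \<gamma>) * Q ^ p + nc + i * ((ma * Q + \<tau> \<gamma>) * Q ^ p + mc)) = F' (\<chi> i + \<gamma> i + \<psi> i)"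
    using resampling_form [OF assms(1,2)] by (elim exE conjE)
  have F': "0 \<le> F' g" for g using F'_bounds by simp
  have mem: "\<chi> i \<in> bg.G" "\<psi> i \<in> bg.G" "- \<chi> i + \<chi> 0 \<in> bg.N_all" "- \<psi> i + \<psi> 0 \<in> bg.N_all"
    if "i < l" for i using memG that by simp_all
  have f: "f ((na * Q + \<beta> \<gamma>) * Q ^ p + nc + i * ((ma * Q + \<tau> \<gamma>) * Q ^ p + mc)) = F' (\<chi> i + \<gamma> i + \<psi> i)"
    if "\<gamma> \<in> NN" "i < l" for \<gamma> i using f_form that by simp
  have l0: "0 < l" using l_ge_2 by simp
  have fin: "finite bg.N_all" by (rule bg.finite_N_all [OF l0])
  define k where "k = real (card bg.N_all)"
  have k: "k > 0" using fin zero_N by (auto simp: k_def card_gt_0_iff)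
  define \<sigma> where "\<sigma> = (\<Sum>g\<in>bg.N_all. F' (\<chi> 0 + g + \<psi> 0))"
  have \<sigma>: "(\<Sum>g\<in>bg.N_all. F' (\<chi> i + g + \<psi> i)) = \<sigma>" if "i < l" for i
    unfolding \<sigma>_def by (rule sum_coset_eq) (use mem that l0 in \<open>auto simp: eqv_def\<close>)
  define \<mu> where "\<mu> = \<sigma> / k"
  have \<sigma>\<mu>: "\<sigma> = k * \<mu>" using k by (simp add: \<mu>_def)
  have \<mu>0: "\<mu> \<ge> 0" using k F' by (simp add: \<mu>_def \<sigma>_def sum_nonneg)
  have s1: "(\<Sum>\<gamma>\<in>NN. \<Prod>i<l. F' (\<chi> i + \<gamma> i + \<psi> i)) = k ^ l * \<mu> ^ l"
  proof -
    have "(\<Sum>\<gamma>\<in>NN. \<Prod>i<l. F' (\<chi> i + \<gamma> i + \<psi> i)) = (\<Prod>i<l. \<Sum>g\<in>bg.N_all. F' (\<chi> i + g + \<psi> i))"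
      unfolding NN_def by (rule prod_sum_PiE [symmetric]) (use fin in auto)
    also have "\<dots> = (\<Prod>i<l. \<sigma>)" by (intro prod.cong) (auto simp: \<sigma>)
    finally show ?thesis by (simp add: \<sigma>\<mu> power_mult_distrib)
  qed
  have s2: "(\<Sum>\<gamma>\<in>NN. F' (\<chi> 0 + \<gamma> 0 + \<psi> 0)) = k ^ l * \<mu>"
  proof -
    \<comment> \<open>Factors 1 in the other coordinates let the same exchange of sum and product
      yield the mean of one coordinate.\<close>
    let ?h = "\<lambda>i g. if i = 0 then F' (\<chi> 0 + g + \<psi> 0) else 1"
    have split: "{..<l} = insert 0 {1..<l}" using l0 by auto
    have "(\<Sum>\<gamma>\<in>NN. F' (\<chi> 0 + \<gamma> 0 + \<psi> 0)) = (\<Sum>\<gamma>\<in>NN. \<Prod>i<l. ?h i (\<gamma> i))"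
      by (intro sum.cong) (simp_all add: split)
    also have "\<dots> = (\<Prod>i<l. \<Sum>g\<in>bg.N_all. ?h i g)"
      unfolding NN_def by (rule prod_sum_PiE [symmetric]) (use fin in auto)
    also have "\<dots> = \<sigma> * k ^ (l - 1)"
      by (simp add: split \<sigma>_def k_def)
    also have "\<dots> = k ^ l * \<mu>" using l0 by (cases l) (auto simp: \<sigma>\<mu>)
    finally show ?thesis .
  qed
  have cNN: "real (card NN) = k ^ l" by (simp add: NN_def card_PiE k_def)
  have "(\<Sum>\<gamma>\<in>NN. \<Delta> a ((na * Q + \<beta> \<gamma>) * Q ^ p + nc) ((ma * Q + \<tau> \<gamma>) * Q ^ p + mc))
      = (\<Sum>\<gamma>\<in>NN. (\<Prod>i<l. F' (\<chi> i + \<gamma> i + \<psi> i)) - (a ^ l + real l * a ^ (l - 1) * (F' (\<chi> 0 + \<gamma> 0 + \<psi> 0) - a)))"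
    using f f [OF _ l0] by (intro sum.cong) (simp_all add: \<Delta>_def)
  also have "\<dots> = k ^ l * \<mu> ^ l - (k ^ l * a ^ l + real l * a ^ (l - 1) * (k ^ l * \<mu> - k ^ l * a))"
    by (simp add: sum_subtractf sum.distrib s1 s2 cNN flip: sum_distrib_left)
  also have "\<dots> = k ^ l * (\<mu> ^ l - (a ^ l + real l * a ^ (l - 1) * (\<mu> - a)))"
    by (simp add: algebra_simps)
  also have "\<dots> \<ge> 0"
    using tangent_power_le [OF assms(3) \<mu>0, of l] l0 k by (intro mult_nonneg_nonneg) auto
  finally show ?thesis .
qed

definition M1 :: "nat set" where
  "M1 = {m. m < Q \<and> D dvd m}"

definition R :: "(nat \<times> nat) set" where
  "R = (\<lambda>\<gamma>. (\<beta> \<gamma>, \<tau> \<gamma>)) ` NN"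

lemma K_gt_0: "0 < K"
  using K_ge_2 by simp

lemma Q_gt_0: "0 < Q"
  by (simp add: Q_def K_gt_0)

lemma R_subset: "R \<subseteq> {..<Q} \<times> M1"
proof -
  have "\<beta> \<gamma> < Q" "\<tau> \<gamma> < Q" "D dvd \<tau> \<gamma>" if "\<gamma> \<in> NN" for \<gamma>
  proof -
    note b = block [OF that]
    have w: "fst (block \<gamma>) < K ^ h0" using b(2) by linarith
    have "\<beta> \<gamma> < d * K ^ (h0 + 2) + (fst (block \<gamma>) + 1) * K ^ 2"
      using d_less K_gt_0 by (simp add: \<beta>_def power2_eq_square)
    also have "\<dots> \<le> d * K ^ (h0 + 2) + K ^ h0 * K ^ 2"
      using w by (intro add_left_mono mult_right_mono) auto
    also have "\<dots> = (d + 1) * K ^ (h0 + 2)" by (simp add: power_add power2_eq_square algebra_simps)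
    also have "\<dots> \<le> K * K ^ (h0 + 2)" using d_less by (intro mult_right_mono) auto
    also have "\<dots> = Q" by (simp add: Q_def eval_nat_numeral)
    finally show "\<beta> \<gamma> < Q" .
    have "1 * snd (block \<gamma>) \<le> (l - 1) * snd (block \<gamma>)" using l_ge_2 by (intro mult_right_mono) auto
    then have "snd (block \<gamma>) < K ^ h0" using b(2) by linarith
    then have "\<tau> \<gamma> < K ^ h0 * K ^ 2" using K_gt_0 by (simp add: \<tau>_def)
    also have "\<dots> \<le> K ^ h0 * K ^ 3"
      using K_gt_0 by (intro mult_left_mono power_increasing) (auto simp: Suc_le_eq)
    finally show "\<tau> \<gamma> < Q" by (simp add: Q_def power_add)
    show "D dvd \<tau> \<gamma>" using b(1) by (simp add: \<tau>_def)
  qed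
  then show ?thesis by (auto simp: R_def M1_def)
qed

lemma inj_block: "inj_on (\<lambda>\<gamma>. (\<beta> \<gamma>, \<tau> \<gamma>)) NN"
proof
  fix \<gamma> \<gamma>' assume \<gamma>: "\<gamma> \<in> NN" "\<gamma>' \<in> NN" and eq: "(\<beta> \<gamma>, \<tau> \<gamma>) = (\<beta> \<gamma>', \<tau> \<gamma>')"
  have "fst (block \<gamma>) = fst (block \<gamma>')" "snd (block \<gamma>) = snd (block \<gamma>')"
    using eq K_gt_0 by (simp_all add: \<beta>_def \<tau>_def)
  then have "\<gamma> i = \<gamma>' i" if "i < l" for i
    using block(3) [OF \<gamma>(1) that] block(3) [OF \<gamma>(2) that] by simp
  then show "\<gamma> = \<gamma>'" using \<gamma> unfolding NN_def by (intro PiE_ext) auto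
qed

lemma card_R: "card R \<ge> 1"
proof -
  have "(\<lambda>i\<in>{..<l}. 0) \<in> NN"
    using normal_subgroup_in.zero_N [OF bg.N_all_normal] by (auto simp: NN_def)
  then have "R \<noteq> {}" "finite R" using finite_NN by (auto simp: R_def)
  then show ?thesis by (simp add: Suc_le_eq card_gt_0_iff)
qed

lemma good_upper_step:
  assumes "good_upper n m" "x < Q" "y \<in> M1"
  shows "good_upper (n * Q + x) (m * Q + y)"
proof -
  obtain U h u where U: "D dvd m" "n = U * K ^ Suc h + d * K ^ h + u" "u + 1 + (l - 1) * (m + 1) \<le> K ^ h"
    using assms(1) by (auto simp: good_upper_def)
  have y: "y < Q" "D dvd y" using assms(3) by (auto simp: M1_def)
  have "n * Q + x = U * K ^ Suc (h + (h0 + 3)) + d * K ^ (h + (h0 + 3)) + (u * Q + x)"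
  proof -
    have "K ^ (h + (h0 + 3)) = K ^ h * Q" "K ^ Suc (h + (h0 + 3)) = K ^ Suc h * Q"
      by (simp_all only: Q_def power_add power_Suc mult.assoc)
    then show ?thesis unfolding U(2) by (simp only: add_mult_distrib mult.assoc add.assoc)
  qed
  moreover have "(u * Q + x) + 1 + (l - 1) * (m * Q + y + 1) \<le> K ^ (h + (h0 + 3))"
  proof -
    define l' where "l' = l - 1"
    have "l' * (m * Q + y + 1) \<le> l' * (m * Q + Q)"
      using y by (intro mult_left_mono) auto
    then have "(u * Q + x) + 1 + (l - 1) * (m * Q + y + 1) \<le> u * Q + Q + l' * (m * Q + Q)"
      using assms(2) unfolding l'_def by linarith
    also have "\<dots> = (u + 1 + l' * (m + 1)) * Q" by (simp add: algebra_simps)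
    also have "\<dots> \<le> K ^ h * Q" using U(3) unfolding l'_def by (intro mult_right_mono) auto
    finally show ?thesis by (simp add: Q_def power_add)
  qed
  moreover have "D dvd m * Q + y" using U(1) y(2) by simp
  ultimately show ?thesis unfolding good_upper_def by blast
qed

lemma good_lower_step:
  assumes "good_lower p n m" "x < Q" "y \<in> M1"
  shows "good_lower (Suc p) (x * Q ^ p + n) (y * Q ^ p + m)"
proof -
  obtain c m' where c: "n < Q ^ p" "m < Q ^ p" "Suc c \<le> (h0 + 3) * p" "m = K ^ Suc c * m'" "D dvd m'"
      "(n div K ^ c) mod K = d"
    using assms(1) by (auto simp: good_lower_def)
  have y: "y < Q" "D dvd y" using assms(3) by (auto simp: M1_def)
  have lt: "x' * Q ^ p + n' < Q ^ Suc p" if "x' < Q" "n' < Q ^ p" for x' n'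
  proof -
    have "x' * Q ^ p + n' < (x' + 1) * Q ^ p" using that by simp
    also have "\<dots> \<le> Q * Q ^ p" using that by (intro mult_right_mono) auto
    finally show ?thesis by simp
  qed
  have Qp: "Q ^ p = K ^ c * (K * K ^ ((h0 + 3) * p - Suc c))"
  proof -
    have "(h0 + 3) * p = c + Suc ((h0 + 3) * p - Suc c)" using c(3) by simp
    then have "Q ^ p = K ^ (c + Suc ((h0 + 3) * p - Suc c))"
      unfolding Q_def power_mult [symmetric] by (rule arg_cong)
    then show ?thesis by (simp only: power_add power_Suc)
  qed
  have xQ: "x * Q ^ p + n = n + K ^ c * (K * (x * K ^ ((h0 + 3) * p - Suc c)))"
    unfolding Qp by (simp add: algebra_simps)
  have "(x * Q ^ p + n) div K ^ c = n div K ^ c + K * (x * K ^ ((h0 + 3) * p - Suc c))"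
    unfolding xQ using K_gt_0 by (subst div_mult_self2) auto
  then have "(x * Q ^ p + n) div K ^ c mod K = d" using c(6) by simp
  moreover have "y * Q ^ p + m = K ^ Suc c * (y * K ^ ((h0 + 3) * p - Suc c) + m')"
    unfolding Qp c(4) by (simp add: algebra_simps)
  moreover have "D dvd y * K ^ ((h0 + 3) * p - Suc c) + m'" using y c(5) by simp
  moreover have "Suc c \<le> (h0 + 3) * Suc p" using c(3) by simp
  ultimately show ?thesis unfolding good_lower_def using lt [OF assms(2) c(1)] lt [OF y(1) c(2)] by blast
qed

section \<open>Windows of free blocks\<close>

definition prepend :: "nat \<Rightarrow> (nat \<times> nat) set \<Rightarrow> (nat \<times> nat) set" where
  "prepend p C = (\<lambda>((x, y), (n, m)). (x * Q ^ p + n, y * Q ^ p + m)) ` (({..<Q} \<times> M1) \<times> C)"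

primrec windows :: "nat \<Rightarrow> (nat \<times> nat) set \<Rightarrow> nat \<Rightarrow> (nat \<times> nat) set" where
  "windows p C 0 = C"
| "windows p C (Suc r) = prepend (p + r) (windows p C r)"

lemma inj_prepend:
  assumes "C \<subseteq> {..<Q ^ p} \<times> {..<Q ^ p}"
  shows "inj_on (\<lambda>((x, y), (n, m)). (x * Q ^ p + n, y * Q ^ p + m)) (B \<times> C)"
proof -
  have dv: "(x * P + n) div P = x" if "n < P" for x n P :: nat
    using that by (auto simp: gr_implies_not0)
  have *: "x = x' \<and> n = n'" if "n < P" "n' < P" "x * P + n = x' * P + n'" for x x' n n' P :: nat
  proof -
    have "x = (x * P + n) div P" by (rule dv [OF that(1), symmetric])
    also have "\<dots> = (x' * P + n') div P" by (simp only: that(3))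
    also have "\<dots> = x'" by (rule dv [OF that(2)])
    finally show ?thesis using that(3) by simp
  qed
  show ?thesis
  proof (rule inj_onI)
    fix c c' assume mem: "c \<in> B \<times> C" "c' \<in> B \<times> C"
      and e: "(\<lambda>((x, y), (n, m)). (x * Q ^ p + n, y * Q ^ p + m)) c
        = (\<lambda>((x, y), (n, m)). (x * Q ^ p + n, y * Q ^ p + m)) c'"
    obtain x y n m x' y' n' m' where c: "c = ((x, y), (n, m))" "c' = ((x', y'), (n', m'))"
      by (metis surj_pair)
    have eq: "x * Q ^ p + n = x' * Q ^ p + n'" "y * Q ^ p + m = y' * Q ^ p + m'"
      using e by (simp_all only: c prod.case prod.inject)
    have "n < Q ^ p" "n' < Q ^ p" "m < Q ^ p" "m' < Q ^ p" using mem assms by (auto simp: c)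
    then show "c = c'"
      unfolding c using * [OF _ _ eq(1)] * [OF _ _ eq(2)] by blast
  qed
qed

lemma finite_M1: "finite M1"
  by (simp add: M1_def)

lemma sum_prepend:
  assumes "C \<subseteq> {..<Q ^ p} \<times> {..<Q ^ p}"
  shows "(\<Sum>c\<in>prepend p C. g c) = (\<Sum>(x, y)\<in>{..<Q} \<times> M1. \<Sum>(n, m)\<in>C. g (x * Q ^ p + n, y * Q ^ p + m))"
  unfolding prepend_def sum.reindex [OF inj_prepend [OF assms]]
  by (simp add: sum.cartesian_product case_prod_beta)

lemma windows_bounds:
  assumes "C \<subseteq> {..<Q ^ p} \<times> {..<Q ^ p}"
  shows "windows p C r \<subseteq> {..<Q ^ (p + r)} \<times> {..<Q ^ (p + r)}"
proof (induction r)
  case (Suc r)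
  have lt: "x * Q ^ (p + r) + n < Q * Q ^ (p + r)" if "x < Q" "n < Q ^ (p + r)" for x n
  proof -
    have "x * Q ^ (p + r) + n < (x + 1) * Q ^ (p + r)" using that by simp
    also have "\<dots> \<le> Q * Q ^ (p + r)" using that by (intro mult_right_mono) auto
    finally show ?thesis .
  qed
  show ?case using Suc lt by (auto simp: prepend_def M1_def dest!: subsetD)
qed (use assms in simp)

lemma windows_card:
  assumes "C \<subseteq> {..<Q ^ p} \<times> {..<Q ^ p}"
  shows "card (windows p C r) = (Q * card M1) ^ r * card C"
proof (induction r)
  case (Suc r)
  have "card (windows p C (Suc r)) = card (({..<Q} \<times> M1) \<times> windows p C r)"
    unfolding windows.simps prepend_def by (rule card_image [OF inj_prepend [OF windows_bounds [OF assms]]])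
  then show ?case using Suc by (simp add: card_cartesian_product)
qed simp

lemma windows_mono: "C \<subseteq> C' \<Longrightarrow> windows p C r \<subseteq> windows p C' r"
proof (induction r)
  case (Suc r)
  then show ?case
    unfolding windows.simps prepend_def by (intro image_mono Sigma_mono) auto
qed simp

lemma windows_good_lower:
  assumes "\<And>n m. (n, m) \<in> C \<Longrightarrow> good_lower p n m"
  shows "(n, m) \<in> windows p C r \<Longrightarrow> good_lower (p + r) n m"
proof (induction r arbitrary: n m)
  case (Suc r)
  then show ?case using good_lower_step by (auto simp: prepend_def)
qed (use assms in auto)

lemma good_lower_bounds: "good_lower p n m \<Longrightarrow> n < Q ^ p \<and> m < Q ^ p"
  by (auto simp: good_lower_def)

text \<open>Peel off the top block. The special choices together contribute a nonnegative amount,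
  whatever stands below; any other choice joins the upper part and the induction continues. Pairs
  are thus sorted by their first special block, and only those without one are charged.\<close>

lemma window_sum:
  assumes "\<And>n m. (n, m) \<in> C \<Longrightarrow> good_lower p n m" "a \<ge> 0" "good_upper n m"
  shows "(\<Sum>(n', m')\<in>windows p C r. \<Delta> a (n * Q ^ (p + r) + n') (m * Q ^ (p + r) + m'))
    \<ge> - (real (Q * card M1 - 1) ^ r * real (card C))"
  using assms(3)
proof (induction r arbitrary: n m)
  case 0
  have "(\<Sum>(n', m')\<in>C. - 1) \<le> (\<Sum>(n', m')\<in>C. \<Delta> a (n * Q ^ p + n') (m * Q ^ p + m'))"
    by (intro sum_mono) (auto simp: \<Delta>_ge assms(2))
  then show ?case by (simp add: case_prod_beta)
next
  case (Suc r)
  let ?P = "Q ^ (p + r)" and ?W = "windows p C r"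
  let ?s = "\<lambda>x y. \<Sum>(n', m')\<in>?W. \<Delta> a ((n * Q + x) * ?P + n') ((m * Q + y) * ?P + m')"
  have C: "C \<subseteq> {..<Q ^ p} \<times> {..<Q ^ p}" using assms(1) good_lower_bounds by fastforce
  have e: "n * Q ^ (p + Suc r) + (x * ?P + n') = (n * Q + x) * ?P + n'" for n x n'
    by (simp add: algebra_simps)
  have "(\<Sum>(n', m')\<in>windows p C (Suc r). \<Delta> a (n * Q ^ (p + Suc r) + n') (m * Q ^ (p + Suc r) + m'))
      = (\<Sum>(x, y)\<in>{..<Q} \<times> M1. ?s x y)"
    unfolding windows.simps sum_prepend [OF windows_bounds [OF C]]
    by (simp only: case_prod_beta prod.sel e)
  also have "\<dots> = (\<Sum>(x, y)\<in>R. ?s x y) + (\<Sum>(x, y)\<in>{..<Q} \<times> M1 - R. ?s x y)"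
    using sum.subset_diff [OF R_subset, of "\<lambda>(x, y). ?s x y"] finite_M1 by (simp add: add.commute)
  finally have eq: "(\<Sum>(n', m')\<in>windows p C (Suc r). \<Delta> a (n * Q ^ (p + Suc r) + n') (m * Q ^ (p + Suc r) + m'))
      = (\<Sum>(x, y)\<in>R. ?s x y) + (\<Sum>(x, y)\<in>{..<Q} \<times> M1 - R. ?s x y)" .
  have 1: "(\<Sum>(x, y)\<in>R. ?s x y) \<ge> 0"
  proof -
    have "(\<Sum>(x, y)\<in>R. ?s x y) = (\<Sum>\<gamma>\<in>NN. ?s (\<beta> \<gamma>) (\<tau> \<gamma>))"
      unfolding R_def sum.reindex [OF inj_block] by simp
    also have "\<dots> = (\<Sum>(n', m')\<in>?W. \<Sum>\<gamma>\<in>NN. \<Delta> a ((n * Q + \<beta> \<gamma>) * ?P + n') ((m * Q + \<tau> \<gamma>) * ?P + m'))"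
      by (subst sum.swap) (simp add: case_prod_beta)
    also have "\<dots> \<ge> 0"
      using resampling_sum [OF Suc.prems windows_good_lower [OF assms(1)] assms(2)]
      by (intro sum_nonneg) auto
    finally show ?thesis .
  qed
  have 2: "(\<Sum>(x, y)\<in>{..<Q} \<times> M1 - R. ?s x y)
      \<ge> (\<Sum>(x, y)\<in>{..<Q} \<times> M1 - R. - (real (Q * card M1 - 1) ^ r * real (card C)))"
  proof (intro sum_mono)
    fix c assume "c \<in> {..<Q} \<times> M1 - R"
    then obtain x y where c: "c = (x, y)" "x < Q" "y \<in> M1" by auto
    have "?s x y \<ge> - (real (Q * card M1 - 1) ^ r * real (card C))"
      using good_upper_step [OF Suc.prems c(2,3)] by (intro Suc.IH)
    then show "(case c of (x, y) \<Rightarrow> ?s x y) \<ge> (case c of (x, y) \<Rightarrow> - (real (Q * card M1 - 1) ^ r * real (card C)))"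
      by (simp add: c)
  qed
  have 3: "(\<Sum>(x, y)\<in>{..<Q} \<times> M1 - R. - (real (Q * card M1 - 1) ^ r * real (card C)))
      \<ge> - (real (Q * card M1 - 1) ^ Suc r * real (card C))"
  proof -
    have finR: "finite R" using finite_NN by (simp add: R_def)
    \<comment> \<open>A single special block already gives the rate, so \<open>card R\<close> is
      bounded below by 1.\<close>
    have "card ({..<Q} \<times> M1 - R) \<le> Q * card M1 - 1"
      using card_R by (simp add: card_Diff_subset [OF finR R_subset] card_cartesian_product)
    then have "real (card ({..<Q} \<times> M1 - R)) * (real (Q * card M1 - 1) ^ r * real (card C))
        \<le> real (Q * card M1 - 1) * (real (Q * card M1 - 1) ^ r * real (card C))"
      by (intro mult_right_mono) auto
    then show ?thesis by (simp add: case_prod_beta)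
  qed
  show ?case unfolding eq using 1 2 3 by linarith
qed

end

section \<open>Anchor blocks and the set of differences\<close>

lemma card_multiples_below:
  fixes D B :: nat
  assumes "D > 0"
  shows "B \<le> card {y. y < B \<and> D dvd y} * D"
proof -
  let ?M = "{y. y < B \<and> D dvd y}"
  have "{..<B} \<subseteq> (\<lambda>(y, e). y + e) ` (?M \<times> {..<D})"
  proof
    fix x assume "x \<in> {..<B}"
    moreover have "x div D * D \<le> x" by simp
    ultimately have "x div D * D < B" by (simp only: lessThan_iff)
    then show "x \<in> (\<lambda>(y, e). y + e) ` (?M \<times> {..<D})"
      using assms by (intro image_eqI [of _ _ "(x div D * D, x mod D)"]) simp_all
  qed
  then have "card {..<B} \<le> card (?M \<times> {..<D})"
    by (rule surj_card_le [rotated]) simp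
  then show ?thesis by (simp add: card_cartesian_product)
qed

context ap_counting
begin

text \<open>An anchor block: the cut d followed by zeros. It is sought in n above and below the
  digits where m may be nonzero; above, the zeros provide the slack that \<open>good_upper\<close>
  demands.\<close>

definition z0 :: nat where
  "z0 = d * K ^ (h0 + 2)"

lemma z0_less: "z0 < Q"
proof -
  have "z0 < K * K ^ (h0 + 2)" using d_less K_gt_0 by (simp add: z0_def)
  then show ?thesis by (simp add: Q_def eval_nat_numeral)
qed

lemma Q_power: "Q ^ j = K ^ ((h0 + 3) * j)"
  by (simp only: Q_def power_mult)

lemma Q_power_z0: "z0 * Q ^ j = d * K ^ ((h0 + 3) * j + (h0 + 2))"
  by (simp add: z0_def Q_power power_add algebra_simps)

lemma Q_power_Suc: "Q * Q ^ j = K ^ Suc ((h0 + 3) * j + (h0 + 2))"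
proof -
  have "Q * Q ^ j = K ^ ((h0 + 3) + (h0 + 3) * j)" by (simp only: Q_def power_mult power_add)
  also have "(h0 + 3) + (h0 + 3) * j = Suc ((h0 + 3) * j + (h0 + 2))" by simp
  finally show ?thesis .
qed

lemma good_upper_zero:
  assumes "n div Q ^ j mod Q = z0"
  shows "good_upper n 0"
proof -
  define h where "h = (h0 + 3) * j + (h0 + 2)"
  define V where "V = n div Q ^ j div Q"
  define u where "u = n mod Q ^ j"
  have "n = n div Q ^ j * Q ^ j + u" by (simp only: u_def div_mult_mod_eq)
  also have "n div Q ^ j = V * Q + z0" using assms by (metis V_def div_mult_mod_eq)
  finally have "n = V * (Q * Q ^ j) + z0 * Q ^ j + u" by (simp add: algebra_simps)
  then have n: "n = V * K ^ Suc h + d * K ^ h + u" unfolding Q_power_Suc Q_power_z0 h_def .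
  have X: "0 < Q ^ j" by (simp add: Q_gt_0)
  have "u + 1 \<le> Q ^ j" using X by (simp add: u_def Suc_le_eq)
  moreover have "l - 1 \<le> Q ^ j * (K - 1)"
  proof -
    have "1 * (K - 1) \<le> Q ^ j * (K - 1)" using X by (intro mult_right_mono) auto
    then show ?thesis using l_le_K by linarith
  qed
  moreover have "Q ^ j + Q ^ j * (K - 1) = Q ^ j * K"
    using mult_Suc_right [of "Q ^ j" "K - 1"] K_gt_0 by simp
  moreover have "Q ^ j * K \<le> Q ^ j * K ^ (h0 + 2)"
    using power_increasing [of 1 "h0 + 2" K] K_gt_0 by (intro mult_left_mono) (auto simp: Suc_le_eq)
  moreover have "Q ^ j * K ^ (h0 + 2) = K ^ h" by (simp add: h_def Q_power power_add)
  ultimately have "u + 1 + (l - 1) \<le> K ^ h" by linarith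
  then have "u + 1 + (l - 1) * (0 + 1) \<le> K ^ h" by simp
  with n show ?thesis unfolding good_upper_def by auto
qed

lemma good_lower_mult:
  assumes "x div Q ^ j mod Q = z0" "j < r" "r \<le> p" "x < Q ^ p" "y * Q ^ r < Q ^ p" "D dvd y"
  shows "good_lower p x (y * Q ^ r)"
proof -
  define c where "c = (h0 + 3) * j + (h0 + 2)"
  define V where "V = x div Q ^ j div Q"
  have "K ^ c = Q ^ j * K ^ (h0 + 2)" by (simp add: c_def Q_power power_add)
  then have "x div K ^ c = x div Q ^ j div K ^ (h0 + 2)" by (simp only: div_mult2_eq)
  also have "x div Q ^ j = V * Q + z0" using assms(1) by (metis V_def div_mult_mod_eq)
  also have "V * Q + z0 = (V * K + d) * K ^ (h0 + 2)"
    by (simp add: Q_def z0_def eval_nat_numeral algebra_simps)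
  also have "\<dots> div K ^ (h0 + 2) = V * K + d" using K_gt_0 by (intro nonzero_mult_div_cancel_right) simp
  finally have 1: "x div K ^ c mod K = d" using d_less by simp
  have sc: "Suc c = (h0 + 3) * Suc j" by (simp add: c_def)
  have 2: "Suc c \<le> (h0 + 3) * p" unfolding sc using assms(2,3) by (intro mult_left_mono) auto
  have "Q ^ r = Q ^ Suc j * Q ^ (r - Suc j)" using assms(2) by (simp flip: power_add power_Suc)
  then have 3: "y * Q ^ r = K ^ Suc c * (y * Q ^ (r - Suc j))"
    by (simp only: sc Q_power ac_simps)
  show ?thesis unfolding good_lower_def using 1 2 3 assms by (metis dvd_mult2)
qed

text \<open>The admissible m do not depend on n, so a sum over a window is a sum over m of complete
  sums over n.\<close>

lemma windows_Times:
  "\<exists>M. windows p ({..<Q ^ p} \<times> B) r = {..<Q ^ (p + r)} \<times> M"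
proof (induction r)
  case (Suc r)
  then obtain M where M: "windows p ({..<Q ^ p} \<times> B) r = {..<Q ^ (p + r)} \<times> M" by blast
  let ?P = "Q ^ (p + r)"
  have P: "?P > 0" by (simp add: Q_gt_0)
  have "windows p ({..<Q ^ p} \<times> B) (Suc r) = {..<Q ^ (p + Suc r)} \<times> (\<lambda>(y, m). y * ?P + m) ` (M1 \<times> M)"
  proof (intro equalityI subsetI)
    fix c assume "c \<in> windows p ({..<Q ^ p} \<times> B) (Suc r)"
    then obtain x y n m where c: "c = (x * ?P + n, y * ?P + m)" "x < Q" "y \<in> M1" "n < ?P" "m \<in> M"
      by (auto simp: prepend_def M)
    have "x * ?P + n < (x + 1) * ?P" using c by simp
    also have "\<dots> \<le> Q * ?P" using c by (intro mult_right_mono) auto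
    finally have "x * ?P + n < Q ^ (p + Suc r)" by simp
    then show "c \<in> {..<Q ^ (p + Suc r)} \<times> (\<lambda>(y, m). y * ?P + m) ` (M1 \<times> M)" using c by auto
  next
    fix c assume "c \<in> {..<Q ^ (p + Suc r)} \<times> (\<lambda>(y, m). y * ?P + m) ` (M1 \<times> M)"
    then obtain n y m where c: "c = (n, y * ?P + m)" "n < Q ^ (p + Suc r)" "y \<in> M1" "m \<in> M" by auto
    have "n div ?P < Q" using c(2) by (intro less_mult_imp_div_less) simp
    moreover have "c = (n div ?P * ?P + n mod ?P, y * ?P + m)" by (simp only: c(1) div_mult_mod_eq)
    ultimately show "c \<in> windows p ({..<Q ^ p} \<times> B) (Suc r)"
      unfolding windows.simps prepend_def M using c P
      by (intro image_eqI [of _ _ "((n div ?P, y), (n mod ?P, m))"]) auto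
  qed
  then show ?case by blast
qed auto

text \<open>1/Q^2 bounds from below both the share of a special pair among
  \<open>Q * card M1\<close> blocks and the share 1/Q of the anchor.\<close>

definition \<theta> :: real where
  "\<theta> = 1 - 1 / (real Q)\<^sup>2"

lemma \<theta>_bounds: "0 \<le> \<theta>" "\<theta> \<le> 1"
  using Q_gt_0 by (auto simp: \<theta>_def)

lemma pred_power_le_\<theta>:
  assumes "0 < w" "w \<le> Q\<^sup>2"
  shows "real (w - 1) ^ r \<le> \<theta> ^ r * real w ^ r"
proof -
  have "real w / (real Q)\<^sup>2 \<le> 1" using assms Q_gt_0 by (simp flip: of_nat_power)
  then have "real (w - 1) \<le> \<theta> * real w" using assms by (simp add: \<theta>_def of_nat_diff algebra_simps)
  then have "real (w - 1) ^ r \<le> (\<theta> * real w) ^ r" by (intro power_mono) auto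
  then show ?thesis by (simp add: power_mult_distrib)
qed

text \<open>Blocks from the bottom: r blocks where m vanishes and n needs an anchor, \<mu> blocks
  that hold an arbitrary multiple of D in m, r window blocks, and r further blocks of n in which an
  anchor is needed again. A missing anchor above, a missing anchor below and a window without
  special block cost \<theta>^r each, hence the factor 3. The \<mu> blocks alone supply Q^\<mu>/D
  differences.\<close>

lemma total_sum:
  assumes "a \<ge> 0"
  shows "\<exists>MM. finite MM \<and> MM \<subseteq> {..<Q ^ (2 * r + \<mu>)} \<and> Q ^ \<mu> \<le> card MM * D \<and>
    (\<Sum>m\<in>MM. \<Sum>n<T * Q ^ (3 * r + \<mu>). \<Delta> a n m)
      \<ge> - (3 * \<theta> ^ r * real (T * Q ^ (3 * r + \<mu>)) * real (card MM))"
proof -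
  define p where "p = \<mu> + r"
  define M0 where "M0 = {y. y < Q ^ \<mu> \<and> D dvd y}"
  define Mid where "Mid = (\<lambda>y. y * Q ^ r) ` M0"
  define P where "P = Q ^ (p + r)"
  define has where "has x \<longleftrightarrow> (\<exists>j<r. x div Q ^ j mod Q = z0)" for x
  define C where "C = {..<Q ^ p} \<times> Mid"
  define Cg where "Cg = {x. x < Q ^ p \<and> has x} \<times> Mid"
  define w where "w = Q * card M1"
  define S where "S n = (\<Sum>(n', m')\<in>windows p C r. \<Delta> a (n * P + n') (0 * P + m'))" for n
  have finM0: "finite M0" "finite Mid" by (simp_all add: M0_def Mid_def)
  have cMid: "card Mid = card M0"
    unfolding Mid_def using Q_gt_0 by (intro card_image) (auto simp: inj_on_def)
  have Mid_less: "y * Q ^ r < Q ^ p" if "y \<in> M0" for y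
    using that Q_gt_0 by (simp add: M0_def p_def power_add)
  have Csub: "C \<subseteq> {..<Q ^ p} \<times> {..<Q ^ p}" using Mid_less by (auto simp: C_def Mid_def)
  have CgC: "Cg \<subseteq> C" by (auto simp: C_def Cg_def)
  have finC: "finite C" using finM0 by (simp add: C_def)
  have Cg_good: "good_lower p n m" if nm: "(n, m) \<in> Cg" for n m
  proof -
    obtain y j where "m = y * Q ^ r" "y \<in> M0" "n < Q ^ p" "j < r" "n div Q ^ j mod Q = z0"
      using nm by (auto simp: Cg_def Mid_def has_def)
    then show ?thesis using Mid_less by (auto simp: M0_def p_def intro!: good_lower_mult)
  qed
  obtain MM where MM: "windows p C r = {..<P} \<times> MM"
    unfolding C_def P_def using windows_Times by blast
  have P0: "P > 0" by (simp add: P_def Q_gt_0)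
  have cW: "card (windows p C r) = w ^ r * card C" unfolding w_def by (rule windows_card [OF Csub])
  have cWg: "card (windows p Cg r) = w ^ r * card Cg"
    unfolding w_def by (rule windows_card) (use CgC Csub in blast)
  have "MM \<subseteq> {..<P}" using windows_bounds [OF Csub, of r] P0 unfolding MM P_def [symmetric] by fastforce
  then have finMM: "finite MM" by (rule finite_subset) simp
  have wc: "w ^ r * card C = P * card MM" using cW by (simp add: MM card_cartesian_product)
  have M1_0: "0 \<in> M1" using Q_gt_0 by (simp add: M1_def)
  have cM1: "card M1 \<ge> 1" using M1_0 finite_M1 by (auto simp: Suc_le_eq card_gt_0_iff)
  have "card M1 \<le> card {..<Q}" by (intro card_mono) (auto simp: M1_def)
  then have wQ: "w \<le> Q\<^sup>2" "w > 0" "Q \<le> w" using cM1 Q_gt_0 by (simp_all add: w_def power2_eq_square)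
  have finWin: "finite (windows p C r)" using finMM by (simp add: MM)
  define B where "B = {x. x < Q ^ p \<and> \<not> has x}"
  have cB: "card B \<le> Q ^ \<mu> * (Q - 1) ^ r"
    using card_avoid_digit [OF z0_less, of "Q ^ \<mu>" r] by (simp add: B_def has_def p_def power_add)
  have pw: "real (w - 1) ^ r \<le> \<theta> ^ r * real w ^ r" by (rule pred_power_le_\<theta>) (use wQ in auto)
  have pQ: "real (Q - 1) ^ r \<le> \<theta> ^ r * real Q ^ r"
    by (rule pred_power_le_\<theta>) (use Q_gt_0 in \<open>auto simp: power2_eq_square\<close>)
  have CB: "card C = card Cg + card B * card Mid"
  proof -
    have "C = Cg \<union> B \<times> Mid" "Cg \<inter> B \<times> Mid = {}" by (auto simp: C_def Cg_def B_def)
    moreover have "finite Cg" "finite (B \<times> Mid)" using finC CgC finite_subset finM0 by (auto simp: B_def)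
    ultimately show ?thesis by (simp add: card_Un_disjoint card_cartesian_product)
  qed
  have CBle: "real (card B * card Mid) \<le> \<theta> ^ r * real (card C)"
  proof -
    have "real (card B) \<le> real (Q ^ \<mu>) * real (Q - 1) ^ r" using cB by (simp flip: of_nat_power of_nat_mult)
    also have "\<dots> \<le> real (Q ^ \<mu>) * (\<theta> ^ r * real Q ^ r)" using pQ by (intro mult_left_mono) auto
    also have "\<dots> = \<theta> ^ r * real (Q ^ p)" by (simp add: p_def power_add)
    finally have "real (card B) * real (card Mid) \<le> \<theta> ^ r * real (Q ^ p) * real (card Mid)"
      by (intro mult_right_mono) auto
    then show ?thesis by (simp add: C_def card_cartesian_product)
  qed
  have all: "S n \<ge> - real (w ^ r * card C)" for n
  proof -
    have "S n \<ge> (\<Sum>(n', m')\<in>windows p C r. - 1)"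
      unfolding S_def by (intro sum_mono) (auto simp: \<Delta>_ge assms)
    then show ?thesis by (simp add: case_prod_beta cW)
  qed
  have good: "S n \<ge> - (2 * \<theta> ^ r * real (w ^ r * card C))" if "has n" for n
  proof -
    have gu: "good_upper n 0" using that good_upper_zero by (auto simp: has_def)
    have sub: "windows p Cg r \<subseteq> windows p C r" by (rule windows_mono [OF CgC])
    have "S n = (\<Sum>(n', m')\<in>windows p C r - windows p Cg r. \<Delta> a (n * P + n') (0 * P + m'))
        + (\<Sum>(n', m')\<in>windows p Cg r. \<Delta> a (n * P + n') (0 * P + m'))"
      unfolding S_def by (rule sum.subset_diff [OF sub finWin])
    moreover have "(\<Sum>(n', m')\<in>windows p Cg r. \<Delta> a (n * P + n') (0 * P + m'))
        \<ge> - (real (w - 1) ^ r * real (card Cg))"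
      unfolding w_def P_def by (rule window_sum [OF Cg_good assms gu])
    moreover have "(\<Sum>(n', m')\<in>windows p C r - windows p Cg r. \<Delta> a (n * P + n') (0 * P + m'))
        \<ge> (\<Sum>(n', m')\<in>windows p C r - windows p Cg r. - 1)"
      by (intro sum_mono) (auto simp: \<Delta>_ge assms)
    moreover have "(\<Sum>(n', m')\<in>windows p C r - windows p Cg r. - 1 :: real)
        = - (real (w ^ r) * real (card B * card Mid))"
    proof -
      have "card (windows p C r - windows p Cg r) = w ^ r * card C - w ^ r * card Cg"
        using cW cWg finite_subset [OF sub finWin] by (simp add: card_Diff_subset [OF _ sub])
      then have "card (windows p C r - windows p Cg r) = w ^ r * (card B * card Mid)"
        by (simp add: CB algebra_simps)
      then show ?thesis by (simp add: case_prod_beta)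
    qed
    moreover have "real (w ^ r) * real (card B * card Mid) \<le> real (w ^ r) * (\<theta> ^ r * real (card C))"
      using CBle by (intro mult_left_mono) auto
    moreover have "real (w - 1) ^ r * real (card Cg) \<le> (\<theta> ^ r * real w ^ r) * real (card C)"
      using pw card_mono [OF finC CgC] \<theta>_bounds by (intro mult_mono) auto
    moreover have "real (w ^ r) * (\<theta> ^ r * real (card C)) = \<theta> ^ r * real (w ^ r * card C)"
      "(\<theta> ^ r * real w ^ r) * real (card C) = \<theta> ^ r * real (w ^ r * card C)"
      by simp_all
    ultimately show ?thesis by linarith
  qed
  define BU where "BU = {n. n < T * Q ^ r \<and> \<not> has n}"
  have BU: "finite BU" "card BU \<le> T * (Q - 1) ^ r"
    using card_avoid_digit [OF z0_less, of T r] by (simp_all add: BU_def has_def)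
  have cBU: "real (card BU) \<le> \<theta> ^ r * real (T * Q ^ r)"
  proof -
    have "real (card BU) \<le> real T * real (Q - 1) ^ r" using BU by (simp flip: of_nat_power of_nat_mult)
    also have "\<dots> \<le> real T * (\<theta> ^ r * real Q ^ r)" using pQ by (intro mult_left_mono) auto
    finally show ?thesis by (simp add: mult.left_commute)
  qed
  let ?W = "real (w ^ r * card C)"
  have pointwise: "(\<Sum>n<T * Q ^ r. S n) \<ge> (\<Sum>n<T * Q ^ r. - (2 * \<theta> ^ r * ?W) - (if n \<in> BU then ?W else 0))"
  proof (rule sum_mono)
    fix n assume "n \<in> {..<T * Q ^ r}"
    then have "n \<in> BU \<longleftrightarrow> \<not> has n" by (simp add: BU_def)
    moreover have "0 \<le> 2 * \<theta> ^ r * ?W" using \<theta>_bounds by simp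
    ultimately show "- (2 * \<theta> ^ r * ?W) - (if n \<in> BU then ?W else 0) \<le> S n"
      using all [of n] good [of n] by (cases "n \<in> BU"; simp only: if_True if_False; linarith)
  qed
  have constants: "(\<Sum>n<T * Q ^ r. - (2 * \<theta> ^ r * ?W) - (if n \<in> BU then ?W else 0))
      = - (real (T * Q ^ r) * (2 * \<theta> ^ r * ?W)) - real (card BU) * ?W"
  proof -
    have "{..<T * Q ^ r} \<inter> BU = BU" by (auto simp: BU_def)
    then have "(\<Sum>n<T * Q ^ r. if n \<in> BU then ?W else 0) = real (card BU) * ?W"
      by (simp add: sum.If_cases)
    then show ?thesis by (simp add: sum_subtractf)
  qed
  have lower: "(\<Sum>n<T * Q ^ r. S n) \<ge> - (real (T * Q ^ r) * (2 * \<theta> ^ r * ?W)) - real (card BU) * ?W"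
    using pointwise unfolding constants .
  have "real (card BU) * ?W \<le> \<theta> ^ r * real (T * Q ^ r) * ?W"
    using cBU by (intro mult_right_mono) auto
  with lower have "(\<Sum>n<T * Q ^ r. S n) \<ge> - (3 * \<theta> ^ r * (real (T * Q ^ r) * ?W))"
    by (simp add: algebra_simps)
  moreover have "real (T * Q ^ r) * ?W = real (T * Q ^ r * P) * real (card MM)"
    unfolding wc by (simp add: algebra_simps)
  moreover have TP: "T * Q ^ r * P = T * Q ^ (3 * r + \<mu>)"
  proof -
    have "3 * r + \<mu> = r + (p + r)" by (simp add: p_def)
    then show ?thesis by (simp only: P_def power_add mult.assoc)
  qed
  moreover have "(\<Sum>n<T * Q ^ r. S n) = (\<Sum>m\<in>MM. \<Sum>n<T * Q ^ (3 * r + \<mu>). \<Delta> a n m)"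
  proof -
    have "(\<Sum>n<T * Q ^ r. S n) = (\<Sum>n<T * Q ^ r. \<Sum>n'<P. \<Sum>m\<in>MM. \<Delta> a (n * P + n') m)"
      unfolding S_def MM by (simp add: sum.cartesian_product)
    also have "\<dots> = (\<Sum>n<T * Q ^ r * P. \<Sum>m\<in>MM. \<Delta> a n m)"
      by (rule sum_digit_split [symmetric])
    also have "\<dots> = (\<Sum>m\<in>MM. \<Sum>n<T * Q ^ r * P. \<Delta> a n m)" by (rule sum.swap)
    finally show ?thesis by (simp only: TP)
  qed
  ultimately have 1: "(\<Sum>m\<in>MM. \<Sum>n<T * Q ^ (3 * r + \<mu>). \<Delta> a n m)
      \<ge> - (3 * \<theta> ^ r * (real (T * Q ^ (3 * r + \<mu>)) * real (card MM)))"
    by (simp only:)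
  have 2: "Q ^ \<mu> \<le> card MM * D"
  proof -
    have "P * card M0 = Q ^ r * (Q ^ p * card Mid)" by (simp add: P_def power_add cMid)
    also have "\<dots> \<le> w ^ r * (Q ^ p * card Mid)" using wQ by (intro mult_right_mono power_mono) auto
    also have "\<dots> = P * card MM" using wc by (simp add: C_def card_cartesian_product)
    finally have "card M0 \<le> card MM" using P0 by simp
    then have "card M0 * D \<le> card MM * D" by simp
    then show ?thesis using card_multiples_below [OF bg.D_pos, of "Q ^ \<mu>"] unfolding M0_def by linarith
  qed
  have "P = Q ^ (2 * r + \<mu>)" by (simp add: P_def p_def mult_2 add.commute add.left_commute)
  then show ?thesis using 1 2 finMM \<open>MM \<subseteq> {..<P}\<close> by (intro exI [of _ MM]) (simp add: mult.assoc)
qed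

end

subsection \<open>Popular differences\<close>

lemma num_aps_eq:
  assumes "l > 0"
  shows "num_aps l A N m = card {n. \<forall>i<l. n + i * m \<in> A \<inter> {..<N}}"
    "finite {n. \<forall>i<l. n + i * m \<in> A \<inter> {..<N}}"
proof -
  let ?S = "{n. \<forall>i<l. n + i * m \<in> A \<inter> {..<N}}"
  have "{n :: int. \<forall>i<l. n + int i * int m \<in> int ` (A \<inter> {..<N})} = int ` ?S"
  proof (intro equalityI subsetI)
    fix n :: int assume n: "n \<in> {n. \<forall>i<l. n + int i * int m \<in> int ` (A \<inter> {..<N})}"
    then have "n + int 0 * int m \<in> int ` (A \<inter> {..<N})" using assms by blast
    then obtain k where k: "n = int k" by auto
    have "k + i * m \<in> A \<inter> {..<N}" if "i < l" for i
    proof -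
      have "int (k + i * m) \<in> int ` (A \<inter> {..<N})" using n that k by simp
      then show ?thesis by (simp only: inj_image_mem_iff [OF inj_of_nat])
    qed
    then show "n \<in> int ` ?S" using k by blast
  next
    fix n assume "n \<in> int ` ?S"
    then show "n \<in> {n. \<forall>i<l. n + int i * int m \<in> int ` (A \<inter> {..<N})}"
      by (auto simp flip: of_nat_mult of_nat_add)
  qed
  then show "num_aps l A N m = card ?S"
    by (simp add: num_aps_def card_image)
  have "?S \<subseteq> {..<N}" using assms by force
  then show "finite ?S" by (rule finite_subset) simp
qed

lemma num_aps_le: "l > 0 \<Longrightarrow> num_aps l A N m \<le> N"
proof -
  assume l: "l > 0"
  have "{n. \<forall>i<l. n + i * m \<in> A \<inter> {..<N}} \<subseteq> {..<N}" using l by force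
  then have "card {n. \<forall>i<l. n + i * m \<in> A \<inter> {..<N}} \<le> card {..<N}" by (intro card_mono) auto
  then show ?thesis using num_aps_eq [OF l] by simp
qed

lemma num_aps_0: "l > 0 \<Longrightarrow> num_aps l A N 0 = card (A \<inter> {..<N})"
proof -
  assume l: "l > 0"
  then have "{n. \<forall>i<l. n + i * 0 \<in> A \<inter> {..<N}} = A \<inter> {..<N}" by auto
  then show ?thesis by (simp only: num_aps_eq(1) [OF l])
qed

text \<open>After division by N, values below the threshold are less than x - \<epsilon> and the
  others are at most 1, so the latter must fill a share \<epsilon>/2 to reach the mean. If x <
  \<epsilon>, the threshold is at most 0 and every m qualifies.\<close>

lemma mean_value_count:
  fixes g :: "'a \<Rightarrow> real"
  assumes "finite M" "\<And>m. m \<in> M \<Longrightarrow> g m \<le> N" "\<And>m. m \<in> M \<Longrightarrow> g m \<ge> 0"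
    and "sum g M \<ge> real (card M) * (x - \<epsilon> / 2) * N" "N > 0" "\<epsilon> > 0" "\<epsilon> \<le> 1"
  shows "real (card {m \<in> M. g m \<ge> (x - \<epsilon>) * N}) \<ge> \<epsilon> / 2 * real (card M)"
proof (cases "x \<ge> \<epsilon>")
  case True
  let ?G = "{m \<in> M. g m \<ge> (x - \<epsilon>) * N}"
  have "sum g M = sum g (M - ?G) + sum g ?G"
    using assms(1) by (intro sum.subset_diff) auto
  also have "sum g (M - ?G) \<le> real (card (M - ?G)) * ((x - \<epsilon>) * N)"
    by (intro sum_bounded_above) auto
  also have "\<dots> \<le> real (card M) * ((x - \<epsilon>) * N)"
    using assms True by (intro mult_right_mono mult_nonneg_nonneg) (auto intro: card_mono)
  also have "sum g ?G \<le> real (card ?G) * N"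
    using assms by (intro sum_bounded_above) auto
  finally have "real (card M) * (x - \<epsilon> / 2) * N \<le> real (card M) * ((x - \<epsilon>) * N) + real (card ?G) * N"
    using assms(4) by simp
  then have "(\<epsilon> / 2 * real (card M)) * N \<le> real (card ?G) * N"
    by (simp add: algebra_simps)
  then show ?thesis using assms(5) by simp
next
  case False
  have "(x - \<epsilon>) * N \<le> 0" using False assms(5) by (intro mult_nonpos_nonneg) auto
  then have "{m \<in> M. g m \<ge> (x - \<epsilon>) * N} = M" using assms(3) by (auto intro: order_trans)
  moreover have "\<epsilon> / 2 * real (card M) \<le> 1 * real (card M)"
    using assms(7) by (intro mult_right_mono) auto
  ultimately show ?thesis by simp
qed

context ap_counting
begin

text \<open>Cutting N down to a multiple of the block length loses at most \<eta> N integers, which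
  costs (l + 1) \<eta> N in the tangent term. Progressions that leave [N] cost a further l \<eta> N
  for each m.\<close>

lemma mean_num_aps:
  assumes A: "\<And>n. f n = (if n \<in> A then 1 else 0)"
    and N: "N \<ge> 1" and \<eta>: "real (Q ^ (3 * r + \<mu>)) \<le> \<eta> * real N" "\<eta> \<le> 1"
    and \<alpha>: "\<alpha> = real (card (A \<inter> {..<N})) / real N"
  shows "\<exists>MM. MM \<subseteq> {..<N} \<and> Q ^ \<mu> \<le> card MM * D \<and>
    (\<Sum>m\<in>MM. real (num_aps l A N m))
      \<ge> real (card MM) * (\<alpha> ^ l - real (2 * l + 1) * \<eta> - 3 * \<theta> ^ r) * real N"
proof -
  define B where "B = Q ^ (3 * r + \<mu>)"
  define T where "T = N div B"
  define N' where "N' = T * B"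
  have B0: "B > 0" by (simp add: B_def Q_gt_0)
  have N'N: "N' \<le> N" by (simp add: N'_def T_def)
  have "N < N' + B" unfolding N'_def T_def 
    using div_mult_mod_eq [of N B] mod_less_divisor [OF B0, of N] by linarith
  then have diff: "real N - real N' \<le> \<eta> * real N" using \<eta>(1) unfolding B_def by linarith
  have \<eta>0: "\<eta> * real N \<ge> 0" using \<eta>(1) by (meson of_nat_0_le_iff order_trans)
  have \<alpha>01: "0 \<le> \<alpha>" "\<alpha> \<le> 1"
  proof -
    have "card (A \<inter> {..<N}) \<le> card {..<N}" by (intro card_mono) auto
    then show "0 \<le> \<alpha>" "\<alpha> \<le> 1" using N by (simp_all add: \<alpha>)
  qed
  obtain MM where MM: "finite MM" "MM \<subseteq> {..<Q ^ (2 * r + \<mu>)}" "Q ^ \<mu> \<le> card MM * D"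
    "(\<Sum>m\<in>MM. \<Sum>n<N'. \<Delta> \<alpha> n m) \<ge> - (3 * \<theta> ^ r * real N' * real (card MM))"
    using total_sum [OF \<alpha>01(1), of r \<mu> T, folded B_def, folded N'_def] by (elim exE conjE)
  have QB: "Q ^ (2 * r + \<mu>) \<le> B"
    unfolding B_def using Q_gt_0 by (intro power_increasing) (auto simp: Suc_le_eq)
  have l0: "l > 0" using l_ge_2 by simp
  define L where "L = real N' * \<alpha> ^ l + real l * \<alpha> ^ (l - 1) * ((\<Sum>n<N'. f n) - \<alpha> * real N')"
  have sumN: "(\<Sum>n<N. f n) = \<alpha> * real N"
  proof -
    have "(\<Sum>n<N. f n) = real (card ({..<N} \<inter> A))"
      by (simp add: A sum.If_cases)
    then show ?thesis using N by (simp add: \<alpha> Int_commute)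
  qed
  have sumN': "(\<Sum>n<N'. f n) \<ge> \<alpha> * real N - (real N - real N')"
  proof -
    have "(\<Sum>n<N. f n) = (\<Sum>n\<in>{..<N} - {..<N'}. f n) + (\<Sum>n<N'. f n)"
      using N'N by (intro sum.subset_diff) auto
    moreover have "(\<Sum>n\<in>{..<N} - {..<N'}. f n) \<le> real (card ({..<N} - {..<N'})) * 1"
      by (intro sum_bounded_above) (simp add: f_bounds)
    moreover have "card ({..<N} - {..<N'}) = N - N'"
      using N'N by (subst card_Diff_subset) auto
    ultimately show ?thesis using sumN N'N by (simp add: of_nat_diff)
  qed
  have L: "L \<ge> real N * \<alpha> ^ l - real (l + 1) * (\<eta> * real N)"
  proof -
    define k where "k = real l * \<alpha> ^ (l - 1)"
    have k: "0 \<le> k" "k \<le> real l"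
      using \<alpha>01 power_le_one [of \<alpha> "l - 1"] mult_left_mono [of "\<alpha> ^ (l - 1)" 1 "real l"] by (simp_all add: k_def)
    define \<delta> where "\<delta> = real N - real N'"
    have \<delta>: "0 \<le> \<delta>" "\<delta> \<le> \<eta> * real N" using N'N diff by (simp_all add: \<delta>_def)
    have "\<alpha> * real N - (real N - real N') - \<alpha> * real N' \<ge> - \<delta>"
    proof -
      have "\<alpha> * real N' \<le> \<alpha> * real N" using \<alpha>01 N'N by (intro mult_left_mono) auto
      then show ?thesis by (simp add: \<delta>_def)
    qed
    then have "(\<Sum>n<N'. f n) - \<alpha> * real N' \<ge> - \<delta>" using sumN' by linarith
    then have "k * ((\<Sum>n<N'. f n) - \<alpha> * real N') \<ge> k * (- \<delta>)" using k by (intro mult_left_mono) auto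
    moreover have "k * \<delta> \<le> real l * \<delta>" using k \<delta> by (intro mult_right_mono) auto
    moreover have "\<delta> * \<alpha> ^ l \<le> \<delta> * 1" using \<alpha>01 \<delta> by (intro mult_left_mono power_le_one) auto
    moreover have "real N' * \<alpha> ^ l = real N * \<alpha> ^ l - \<delta> * \<alpha> ^ l" by (simp add: \<delta>_def algebra_simps)
    moreover have "real (l + 1) * \<delta> \<le> real (l + 1) * (\<eta> * real N)" using \<delta> by (intro mult_left_mono) auto
    moreover have "real (l + 1) * \<delta> = real l * \<delta> + \<delta>" by (simp add: algebra_simps)
    ultimately show ?thesis unfolding L_def k_def [symmetric] by linarith
  qed
  have aps: "(\<Sum>n<N'. \<Prod>i<l. f (n + i * m)) \<le> real (num_aps l A N m) + real l * (\<eta> * real N)"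
    if m: "m \<in> MM" for m
  proof -
    let ?S = "{n. \<forall>i<l. n + i * m \<in> A \<inter> {..<N}}"
    have "(\<Prod>i<l. f (n + i * m)) = (if \<forall>i<l. n + i * m \<in> A then 1 else 0)" for n
      by (auto simp: A)
    then have eq: "(\<Sum>n<N'. \<Prod>i<l. f (n + i * m)) = real (card ({..<N'} \<inter> {n. \<forall>i<l. n + i * m \<in> A}))"
      by (simp add: sum.If_cases)
    \<comment> \<open>Only the last l m starting points can lead out of [N].\<close>
    have "{..<N'} \<inter> {n. \<forall>i<l. n + i * m \<in> A} \<subseteq> ?S \<union> {N - l * m..<N}"
    proof
      fix n assume n: "n \<in> {..<N'} \<inter> {n. \<forall>i<l. n + i * m \<in> A}"
      show "n \<in> ?S \<union> {N - l * m..<N}"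
      proof (cases "n < N - l * m")
        case True
        have "n + i * m < N" if "i < l" for i
        proof -
          have "i * m \<le> l * m" using that by (intro mult_right_mono) auto
          then show ?thesis using True by linarith
        qed
        then show ?thesis using n by auto
      qed (use n N'N in auto)
    qed
    then have "card ({..<N'} \<inter> {n. \<forall>i<l. n + i * m \<in> A}) \<le> card (?S \<union> {N - l * m..<N})"
      by (rule card_mono [rotated]) (intro finite_UnI num_aps_eq(2) [OF l0] finite_atLeastLessThan)
    also have "\<dots> \<le> card ?S + card {N - l * m..<N}" by (rule card_Un_le)
    also have "\<dots> \<le> num_aps l A N m + l * m" unfolding num_aps_eq(1) [OF l0] by simp
    finally have "real (card ({..<N'} \<inter> {n. \<forall>i<l. n + i * m \<in> A})) \<le> real (num_aps l A N m) + real l * real m"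
      by (simp flip: of_nat_mult of_nat_add)
    moreover have "real l * real m \<le> real l * (\<eta> * real N)"
    proof (rule mult_left_mono)
      have "m \<le> B" using MM(2) m QB by force
      then show "real m \<le> \<eta> * real N" using \<eta>(1) unfolding B_def by linarith
    qed simp
    ultimately show ?thesis unfolding eq by linarith
  qed
  have "(\<Sum>m\<in>MM. \<Sum>n<N'. \<Delta> \<alpha> n m) = (\<Sum>m\<in>MM. (\<Sum>n<N'. \<Prod>i<l. f (n + i * m)) - L)"
    unfolding \<Delta>_def L_def sum_subtractf sum.distrib sum_distrib_left [symmetric]
    by (simp add: sum_subtractf)
  also have "\<dots> \<le> (\<Sum>m\<in>MM. real (num_aps l A N m) + (real l * (\<eta> * real N) - L))"
  proof (rule sum_mono)
    fix m assume "m \<in> MM"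
    from aps [OF this] show "(\<Sum>n<N'. \<Prod>i<l. f (n + i * m)) - L
        \<le> real (num_aps l A N m) + (real l * (\<eta> * real N) - L)" by linarith
  qed
  also have "\<dots> = (\<Sum>m\<in>MM. real (num_aps l A N m)) + real (card MM) * (real l * (\<eta> * real N) - L)"
    by (simp add: sum.distrib)
  finally have "(\<Sum>m\<in>MM. real (num_aps l A N m))
      \<ge> real (card MM) * (L - real l * (\<eta> * real N)) - 3 * \<theta> ^ r * real N' * real (card MM)"
    using MM(4) by (simp add: algebra_simps)
  moreover have "3 * \<theta> ^ r * real N' * real (card MM) \<le> 3 * \<theta> ^ r * real N * real (card MM)"
    using \<theta>_bounds N'N by (intro mult_right_mono mult_left_mono) auto
  moreover have "real (card MM) * (L - real l * (\<eta> * real N))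
      \<ge> real (card MM) * (real N * \<alpha> ^ l - real (2 * l + 1) * (\<eta> * real N))"
    using L by (intro mult_left_mono) (simp_all add: algebra_simps)
  ultimately have "(\<Sum>m\<in>MM. real (num_aps l A N m))
      \<ge> real (card MM) * (\<alpha> ^ l - real (2 * l + 1) * \<eta> - 3 * \<theta> ^ r) * real N"
    by (simp add: algebra_simps)
  moreover have "MM \<subseteq> {..<N}"
  proof -
    have "real B \<le> 1 * real N" using \<eta> unfolding B_def by (meson mult_right_mono of_nat_0_le_iff order_trans)
    then have "B \<le> N" by simp
    then show ?thesis using MM(2) QB by force
  qed
  ultimately show ?thesis using MM(3) by blast
qed

lemma count_good_differences:
  assumes A: "\<And>n. f n = (if n \<in> A then 1 else 0)"
    and N: "N \<ge> 1" and \<eta>: "real (Q ^ (3 * r + \<mu>)) \<le> \<eta> * real N" "\<eta> \<le> 1"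
    and \<alpha>: "\<alpha> = real (card (A \<inter> {..<N})) / real N"
    and \<epsilon>: "0 < \<epsilon>" "\<epsilon> \<le> 1" "real (2 * l + 1) * \<eta> + 3 * \<theta> ^ r \<le> \<epsilon> / 2"
  shows "real (card {m \<in> {..<N}. real (num_aps l A N m) \<ge> (\<alpha> ^ l - \<epsilon>) * real N})
    \<ge> \<epsilon> / 2 * (real (Q ^ \<mu>) / real D)"
proof -
  have l0: "l > 0" using l_ge_2 by simp
  obtain MM where MM: "MM \<subseteq> {..<N}" "Q ^ \<mu> \<le> card MM * D"
    "(\<Sum>m\<in>MM. real (num_aps l A N m))
      \<ge> real (card MM) * (\<alpha> ^ l - real (2 * l + 1) * \<eta> - 3 * \<theta> ^ r) * real N"
    using mean_num_aps [OF A N \<eta> \<alpha>] by (elim exE conjE)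
  have fin: "finite MM" using MM(1) by (rule finite_subset) simp
  have "real (card MM) * (\<alpha> ^ l - \<epsilon> / 2) * real N
      \<le> real (card MM) * (\<alpha> ^ l - real (2 * l + 1) * \<eta> - 3 * \<theta> ^ r) * real N"
    using \<epsilon>(3) by (intro mult_right_mono mult_left_mono) auto
  also note MM(3)
  finally have "\<epsilon> / 2 * real (card MM) \<le> real (card {m \<in> MM. real (num_aps l A N m) \<ge> (\<alpha> ^ l - \<epsilon>) * real N})"
    using fin N \<epsilon> num_aps_le [OF l0] by (intro mean_value_count) auto
  also have "\<dots> \<le> real (card {m \<in> {..<N}. real (num_aps l A N m) \<ge> (\<alpha> ^ l - \<epsilon>) * real N})"
    unfolding of_nat_le_iff using MM(1) by (intro card_mono) auto
  finally have "\<epsilon> / 2 * real (card MM) \<le> real (card {m \<in> {..<N}. real (num_aps l A N m) \<ge> (\<alpha> ^ l - \<epsilon>) * real N})" .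
  moreover have "real (Q ^ \<mu>) / real D \<le> real (card MM)"
    using MM(2) bg.D_pos by (simp add: pos_divide_le_eq flip: of_nat_mult)
  then have "\<epsilon> / 2 * (real (Q ^ \<mu>) / real D) \<le> \<epsilon> / 2 * real (card MM)"
    using \<epsilon>(1) by (intro mult_left_mono) auto
  ultimately show ?thesis by linarith
qed

text \<open>Step 0 gives \<alpha> N \<ge> \<alpha>^l N progressions. This settles those N that are
  too small for the block layout.\<close>

lemma zero_is_good:
  assumes N: "N \<ge> 1" and \<alpha>: "\<alpha> = real (card (A \<inter> {..<N})) / real N" and "\<epsilon> > 0"
  shows "1 \<le> card {m \<in> {..<N}. real (num_aps l A N m) \<ge> (\<alpha> ^ l - \<epsilon>) * real N}"
proof -
  have l0: "l > 0" using l_ge_2 by simp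
  have "card (A \<inter> {..<N}) \<le> card {..<N}" by (intro card_mono) auto
  then have "0 \<le> \<alpha>" "\<alpha> \<le> 1" using N by (simp_all add: \<alpha>)
  then have "\<alpha> ^ l \<le> \<alpha>" using l0 power_decreasing [of 1 l \<alpha>] by simp
  then have "(\<alpha> ^ l - \<epsilon>) * real N \<le> \<alpha> * real N" using assms(3) by (intro mult_right_mono) auto
  also have "\<dots> = real (num_aps l A N 0)" using N by (simp add: num_aps_0 [OF l0] \<alpha>)
  finally have "0 \<in> {m \<in> {..<N}. real (num_aps l A N m) \<ge> (\<alpha> ^ l - \<epsilon>) * real N}" using N by simp
  moreover have "finite {m \<in> {..<N}. real (num_aps l A N m) \<ge> (\<alpha> ^ l - \<epsilon>) * real N}" by simp
  ultimately show ?thesis by (metis One_nat_def Suc_le_eq card_gt_0_iff empty_iff)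
qed

section \<open>Choice of parameters\<close>

lemma popular_differences:
  assumes A: "\<And>n. f n = (if n \<in> A then 1 else 0)"
  shows "\<exists>C c :: real. c > 0 \<and>
    (\<forall>(N :: nat) (\<epsilon> :: real). N \<ge> 1 \<longrightarrow> \<epsilon> > 0 \<longrightarrow> \<epsilon> \<le> 1 \<longrightarrow>
      real (card {m \<in> {..<N}. real (num_aps l A N m)
          \<ge> ((real (card (A \<inter> {..<N})) / real N) ^ l - \<epsilon>) * real N})
        \<ge> c * \<epsilon> powr C * real N)"
proof -
  define q where "q = real Q"
  have "K ^ 1 \<le> K ^ (h0 + 3)" using K_gt_0 by (intro power_increasing) (auto simp: Suc_le_eq)
  then have "2 \<le> Q" using K_ge_2 by (simp add: Q_def)
  then have q: "q \<ge> 2" by (simp add: q_def)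
  \<comment> \<open>Chosen such that r \<le> q^2 ln (12/\<epsilon>) + 1 gives q^(3 r) \<le> q^3
    (12/\<epsilon>)^E.\<close>
  define E where "E = 3 * q\<^sup>2 * ln q"
  define B where "B = q ^ 3 * 12 powr E"
  define H where "H = 4 * real (2 * l + 1)"
  \<comment> \<open>The factors come from the share \<epsilon>/2 of good differences, the
    restriction to multiples of D, the definition of \<eta>, the rounding to a power of q, and the
    bound on q^(3 r).\<close>
  define c where "c = 1 / (2 * real D * H * q * B)"
  have pos: "B > 0" "H \<ge> 1" "real D \<ge> 1" using q bg.D_pos by (simp_all add: B_def H_def Suc_le_eq)
  have E0: "E \<ge> 0" using q by (simp add: E_def)
  show ?thesis
  proof (intro exI conjI allI impI)
    show "c > 0" using pos q by (simp add: c_def)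
    fix N :: nat and \<epsilon> :: real
    assume N: "N \<ge> 1" and \<epsilon>: "\<epsilon> > 0" "\<epsilon> \<le> 1"
    define \<alpha> where "\<alpha> = real (card (A \<inter> {..<N})) / real N"
    let ?good = "real (card {m \<in> {..<N}. real (num_aps l A N m) \<ge> (\<alpha> ^ l - \<epsilon>) * real N})"
    \<comment> \<open>As \<theta> \<le> exp (-1/q^2), this makes 3 \<theta>^r at most \<epsilon>/4,
      half of the permitted error; \<eta> is chosen to use the other half.\<close>
    define r where "r = nat \<lceil>q\<^sup>2 * ln (12 / \<epsilon>)\<rceil>"
    have ln0: "ln (12 / \<epsilon>) \<ge> 0" using \<epsilon> by simp
    then have "q\<^sup>2 * ln (12 / \<epsilon>) \<ge> 0" by simp
    then have r: "q\<^sup>2 * ln (12 / \<epsilon>) \<le> real r" "real r \<le> q\<^sup>2 * ln (12 / \<epsilon>) + 1"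
      unfolding r_def by linarith+
    have \<theta>r: "\<theta> ^ r \<le> \<epsilon> / 12"
    proof -
      have "\<theta> \<le> exp (- 1 / q\<^sup>2)"
        using exp_ge_add_one_self [of "- 1 / q\<^sup>2"] by (simp add: \<theta>_def q_def)
      then have "\<theta> ^ r \<le> exp (- 1 / q\<^sup>2) ^ r" using \<theta>_bounds by (intro power_mono) auto
      also have "\<dots> = exp (- (real r / q\<^sup>2))" by (simp flip: exp_of_nat_mult)
      also have "\<dots> \<le> exp (- ln (12 / \<epsilon>))"
        using r(1) q by (simp add: pos_le_divide_eq mult.commute)
      also have "\<dots> = \<epsilon> / 12" using \<epsilon> by (simp add: exp_minus)
      finally show ?thesis .
    qed
    have Q3r: "q ^ (3 * r) \<le> B * \<epsilon> powr (- E)"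
    proof -
      have "q ^ (3 * r) = q powr (3 * real r)" using q by (simp flip: powr_realpow)
      also have "\<dots> \<le> q powr (3 * (q\<^sup>2 * ln (12 / \<epsilon>) + 1))" using r q by (intro powr_mono) auto
      also have "\<dots> = exp (E * ln (12 / \<epsilon>)) * q powr 3"
        using q by (simp add: powr_def E_def algebra_simps flip: exp_add)
      also have "exp (E * ln (12 / \<epsilon>)) = 12 powr E * \<epsilon> powr (- E)"
        using \<epsilon> by (simp add: powr_def ln_div algebra_simps flip: exp_add)
      also have "q powr 3 = q ^ 3" using q by simp
      finally show ?thesis by (simp add: B_def mult_ac)
    qed
    define \<eta> where "\<eta> = \<epsilon> / H"
    have \<eta>: "\<eta> > 0" "\<eta> \<le> 1" using \<epsilon> pos by (simp_all add: \<eta>_def)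
    have H\<eta>: "real (2 * l + 1) * \<eta> = \<epsilon> / 4"
    proof -
      have "a * (\<epsilon> / (4 * a)) = \<epsilon> / 4" if "a \<noteq> 0" for a :: real using that by simp
      from this [of "real (2 * l + 1)"] show ?thesis unfolding \<eta>_def H_def by simp
    qed
    have small: "real (2 * l + 1) * \<eta> + 3 * \<theta> ^ r \<le> \<epsilon> / 2" using H\<eta> \<theta>r by linarith
    \<comment> \<open>E pays for q^(3 r), one more power for \<eta>, and one for the share
      \<epsilon>/2.\<close>
    have "?good \<ge> c * \<epsilon> powr (E + 2) * real N"
    proof (cases "q ^ (3 * r) \<le> \<eta> * real N")
      \<comment> \<open>Here N is too small for 3 r blocks. The bound to be shown is then at most 1,
        so m = 0 is enough.\<close>
      case False
      then have "\<eta> * real N \<le> B * \<epsilon> powr (- E)" using Q3r by linarith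
      then have "\<epsilon> * real N \<le> H * B * \<epsilon> powr (- E)" using pos by (simp add: \<eta>_def field_simps)
      then have "\<epsilon> * real N * \<epsilon> powr (E + 1) \<le> H * B * \<epsilon> powr (- E) * \<epsilon> powr (E + 1)"
        by (intro mult_right_mono) auto
      also have "H * B * \<epsilon> powr (- E) * \<epsilon> powr (E + 1) = H * B * \<epsilon>"
        using \<epsilon> by (simp add: mult.assoc flip: powr_add)
      also have "\<epsilon> * real N * \<epsilon> powr (E + 1) = \<epsilon> powr (E + 2) * real N"
        using \<epsilon> powr_add [of \<epsilon> "E + 1" 1] by (simp add: add.assoc)
      finally have "c * (\<epsilon> powr (E + 2) * real N) \<le> c * (H * B * \<epsilon>)"
        using pos q by (intro mult_left_mono) (auto simp: c_def)
      also have "\<dots> = \<epsilon> / (2 * real D * q)" using pos q by (simp add: c_def field_simps)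
      also have "\<dots> \<le> 1"
      proof -
        have "1 * 1 \<le> real D * q" using pos q by (intro mult_mono) auto
        then have "0 < 2 * real D * q" "\<epsilon> \<le> 1 * (2 * real D * q)" using \<epsilon> by linarith+
        then show ?thesis by (simp only: pos_divide_le_eq)
      qed
      also have "1 \<le> ?good" using zero_is_good [OF N \<alpha>_def \<epsilon>(1)] by linarith
      finally show ?thesis by (simp add: mult.assoc)
    next
      case True
      let ?P = "\<lambda>\<mu>. q ^ (3 * r + \<mu>) \<le> \<eta> * real N"
      have "\<exists>\<mu>. \<not> ?P \<mu>"
      proof -
        obtain \<mu> where "\<eta> * real N < q ^ \<mu>" using real_arch_pow [of q "\<eta> * real N"] q by auto
        also have "q ^ \<mu> \<le> q ^ (3 * r + \<mu>)" using q by (intro power_increasing) auto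
        finally show ?thesis by (auto simp: not_le)
      qed
      \<comment> \<open>The predecessor of the first failure is the largest admissible \<mu>;
        maximality loses only a factor q.\<close>
      define \<nu> where "\<nu> = (LEAST \<mu>. \<not> ?P \<mu>)"
      have \<nu>: "\<not> ?P \<nu>" unfolding \<nu>_def by (rule LeastI_ex) fact
      then obtain \<mu> where \<mu>: "\<nu> = Suc \<mu>" using True by (cases \<nu>) auto
      have P: "?P \<mu>" using not_less_Least [of \<mu> "\<lambda>\<mu>. \<not> ?P \<mu>"] \<mu> by (simp add: \<nu>_def)
      have "\<eta> * real N \<le> q ^ (3 * r) * q * q ^ \<mu>" using \<nu> by (simp add: \<mu> power_add mult_ac)
      also have "\<dots> \<le> (B * \<epsilon> powr (- E)) * q * q ^ \<mu>" using Q3r q by (intro mult_right_mono) auto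
      finally have "\<eta> * real N * \<epsilon> powr E \<le> (B * \<epsilon> powr (- E)) * q * q ^ \<mu> * \<epsilon> powr E"
        by (intro mult_right_mono) auto
      also have "\<dots> = B * q * q ^ \<mu> * (\<epsilon> powr (- E) * \<epsilon> powr E)" by (simp only: mult_ac)
      also have "\<epsilon> powr (- E) * \<epsilon> powr E = 1" using \<epsilon> by (simp flip: powr_add)
      finally have low: "\<eta> * real N * \<epsilon> powr E \<le> B * q * q ^ \<mu>" by simp
      have "c * \<epsilon> powr (E + 2) * real N = \<epsilon> / (2 * real D * q * B) * (\<eta> * real N * \<epsilon> powr E)"
        using \<epsilon> pos q by (simp add: c_def \<eta>_def powr_add power2_eq_square field_simps)
      also have "\<dots> \<le> \<epsilon> / (2 * real D * q * B) * (B * q * q ^ \<mu>)"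
        using low \<epsilon> pos q by (intro mult_left_mono) auto
      also have "\<dots> = \<epsilon> / 2 * (real (Q ^ \<mu>) / real D)"
        using pos q by (simp add: q_def field_simps)
      also have "\<dots> \<le> ?good"
        using P by (intro count_good_differences [OF A N _ \<eta>(2) \<alpha>_def \<epsilon> small]) (simp add: q_def)
      finally show ?thesis .
    qed
    then show "real (card {m \<in> {..<N}. real (num_aps l A N m)
          \<ge> ((real (card (A \<inter> {..<N})) / real N) ^ l - \<epsilon>) * real N})
        \<ge> c * \<epsilon> powr (E + 2) * real N" by (simp only: \<alpha>_def)
  qed
qed

end

subsection \<open>Reset words\<close>

lemma act_power:
  assumes "k > 0"
  shows "act (\<lambda>s a. act \<delta> k E a s) (k ^ E) h n s = act \<delta> k (E * h) n s"
proof (induction h arbitrary: n)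
  case (Suc h)
  have "act \<delta> k (E * Suc h) n s = act \<delta> k (E * h + E) n s" by (simp add: add.commute)
  then show ?case using Suc by (simp add: act_add act_mod)
qed simp

lemma funpow_word:
  assumes "k > 0"
  shows "\<exists>n. \<forall>s. act \<delta> k (h * j) n s = (act \<delta> k h w ^^ j) s"
proof (induction j)
  case (Suc j)
  then obtain n where n: "\<And>s. act \<delta> k (h * j) n s = (act \<delta> k h w ^^ j) s" by blast
  define n' where "n' = w mod k ^ h + k ^ h * n"
  have 1: "n' div k ^ h = n" using assms by (simp add: n'_def)
  have 2: "n' mod k ^ h = w mod k ^ h" by (simp add: n'_def)
  have "act \<delta> k (h * Suc j) n' s = (act \<delta> k h w ^^ Suc j) s" for s
  proof -
    have "act \<delta> k (h * Suc j) n' s = act \<delta> k (h * j + h) n' s" by (simp add: add.commute)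
    also have "\<dots> = act \<delta> k h n' (act \<delta> k (h * j) n s)" by (simp only: act_add 1)
    also have "\<dots> = act \<delta> k h (n' mod k ^ h) ((act \<delta> k h w ^^ j) s)" by (simp only: n act_mod)
    also have "\<dots> = (act \<delta> k h w ^^ Suc j) s" by (simp only: 2 act_mod) simp
    finally show ?thesis .
  qed
  then show ?case by blast
qed simp

lemma bij_betw_finite_nilpotent:
  assumes "bij_betw a X X" "finite X"
  shows "\<exists>j>0. \<forall>x\<in>X. (a ^^ j) x = x"
proof -
  define p where "p x = (if x \<in> X then a x else x)" for x
  have "p permutes X"
  proof (rule bij_imp_permutes)
    show "bij_betw p X X" using assms(1) by (rule bij_betw_cong [THEN iffD1, rotated]) (simp add: p_def)
  qed (simp add: p_def)
  then have "permutation p" using assms(2) permutation_permutes by blast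
  then obtain j where j: "p ^^ j = id" "j > 0" using permutation_is_nilpotent by blast
  have "(a ^^ i) x = (p ^^ i) x \<and> (a ^^ i) x \<in> X" if "x \<in> X" for i x
    using that assms(1) by (induction i) (auto simp: p_def bij_betw_def)
  then show ?thesis using j by (intro exI [of _ j]) auto
qed

text \<open>A nonempty word of minimal rank permutes its own image X, since no word can merge states
  of X. A suitable power of it is the identity on X, hence idempotent on S, and becomes a single
  digit in base k^E.\<close>

lemma reset_word_exists:
  assumes "k \<ge> 2" "finite S" "\<And>s a. s \<in> S \<Longrightarrow> a < k \<Longrightarrow> \<delta> s a \<in> S"
  shows "\<exists>E d. l \<le> k ^ E \<and> reset_automaton (k ^ E) d (\<lambda>s a. act \<delta> k E a s) S"
proof -
  have k0: "k > 0" using assms(1) by simp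
  have closed: "act \<delta> k h n s \<in> S" if "s \<in> S" for h n s
    by (intro act_closed assms(3) k0 that)
  \<comment> \<open>\<open>Suc h\<close> restricts the minimum to nonempty words, as d has to have
    positive length.\<close>
  define rank where "rank = (\<lambda>(h, n). card (act \<delta> k (Suc h) n ` S))"
  obtain h' n0 where min: "\<And>h n. rank (h', n0) \<le> rank (h, n)"
    using ex_has_least_nat [of "\<lambda>_. True" "(0, 0)" rank] by (metis surj_pair)
  define h0 where "h0 = Suc h'"
  define a where "a = act \<delta> k h0 n0"
  define X where "X = a ` S"
  have finX: "finite X" using assms(2) by (simp add: X_def)
  have XS: "X \<subseteq> S" using closed by (auto simp: X_def a_def)
  have least: "card X \<le> card (act \<delta> k h n ` S)" if "h > 0" for h n
    using min [of "h - 1" n] that by (simp add: rank_def X_def a_def h0_def del: act.simps)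
  have word2: "\<exists>n. \<forall>s. act \<delta> k (h1 + h2) n s = act \<delta> k h2 n2 (act \<delta> k h1 n1 s)" for h1 n1 h2 n2
  proof (intro exI allI)
    fix s
    have "(n2 mod k ^ h2 + k ^ h2 * n1) mod k ^ h2 = n2 mod k ^ h2" by simp
    moreover have "(n2 mod k ^ h2 + k ^ h2 * n1) div k ^ h2 = n1" using k0 by simp
    ultimately show "act \<delta> k (h1 + h2) (n2 mod k ^ h2 + k ^ h2 * n1) s = act \<delta> k h2 n2 (act \<delta> k h1 n1 s)"
      unfolding act_add by (metis act_mod)
  qed
  have inj_word: "inj_on (act \<delta> k h n) X" for h n
  proof -
    obtain m where "\<And>s. act \<delta> k (h0 + h) m s = act \<delta> k h n (a s)"
      using word2 [of h0 h n n0] unfolding a_def by blast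
    then have "act \<delta> k (h0 + h) m ` S = act \<delta> k h n ` X" by (auto simp: X_def)
    then have "card X \<le> card (act \<delta> k h n ` X)" using least [of "h0 + h" m] by (simp add: h0_def)
    then show ?thesis using card_image_le [OF finX] by (intro eq_card_imp_inj_on finX antisym)
  qed
  have aX: "a ` X \<subseteq> X" using XS by (auto simp: X_def)
  have "bij_betw a X X"
    unfolding bij_betw_def
    by (intro conjI endo_inj_surj finX aX) (unfold a_def, rule inj_word, rule inj_word)
  from bij_betw_finite_nilpotent [OF this finX]
  obtain j where j: "j > 0" "\<And>x. x \<in> X \<Longrightarrow> (a ^^ j) x = x"
    by blast
  \<comment> \<open>The factor l + 1 lengthens the word until l \<le> E, which gives l \<le>
    k^E.\<close>
  define J where "J = j * (l + 1)"
  have aJ: "(a ^^ J) x = x" if "x \<in> X" for x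
  proof -
    have "(a ^^ (j * i)) x = x" for i
      by (induction i) (simp_all add: funpow_add j(2) [OF that])
    then show ?thesis by (simp only: J_def)
  qed
  define E where "E = h0 * J"
  have lE: "l \<le> E"
  proof -
    have "1 * (1 * (l + 1)) \<le> h0 * (j * (l + 1))" using j(1) by (intro mult_le_mono) (auto simp: h0_def)
    then show ?thesis by (simp add: E_def J_def)
  qed
  obtain n where n: "\<And>s. act \<delta> k E n s = (a ^^ J) s"
    using funpow_word [OF k0, of \<delta> h0 J n0] unfolding E_def a_def by blast
  define d where "d = n mod k ^ E"
  have d: "act \<delta> k E d s = (a ^^ J) s" for s by (simp add: d_def act_mod n)
  have into: "(a ^^ J) s \<in> X" if "s \<in> S" for s
  proof -
    have "J > 0" using j by (simp add: J_def)
    then obtain i where i: "J = Suc i" using gr0_conv_Suc by blast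
    have "(a ^^ i) s \<in> S" using that closed by (induction i) (auto simp: a_def)
    then show ?thesis by (simp add: i X_def)
  qed
  have E0: "E > 0" using j by (simp add: E_def J_def h0_def)
  have pow: "x < k ^ x" for x
  proof -
    have "x < 2 ^ x" by (rule less_exp)
    also have "\<dots> \<le> k ^ x" using assms(1) by (intro power_mono) auto
    finally show ?thesis .
  qed
  have "l \<le> k ^ E" using lE pow [of E] by linarith
  moreover have "reset_automaton (k ^ E) d (\<lambda>s a. act \<delta> k E a s) S"
  proof
    show "2 \<le> k ^ E" using E0 assms(1) power_increasing [of 1 E k] by simp
    show "d < k ^ E" using k0 by (simp add: d_def)
    show "finite S" by fact
    show "act \<delta> k E b s \<in> S" if "s \<in> S" for s b by (rule closed [OF that])
    show "act \<delta> k E d (act \<delta> k E d s) = act \<delta> k E d s" if "s \<in> S" for s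
      using aJ [OF into [OF that]] by (simp add: d)
    show "inj_on (\<lambda>x. act \<delta> k E d (act (\<lambda>s a. act \<delta> k E a s) (k ^ E) h m x)) ((\<lambda>s. act \<delta> k E d s) ` S)" for h m
    proof -
      obtain m' where m': "\<And>s. act \<delta> k (E * h + E) m' s = act \<delta> k E d (act \<delta> k (E * h) m s)"
        using word2 [of "E * h" E d m] by blast
      have "(\<lambda>s. act \<delta> k E d s) ` S \<subseteq> X" using into by (auto simp: d)
      then have "inj_on (act \<delta> k (E * h + E) m') ((\<lambda>s. act \<delta> k E d s) ` S)"
        by (rule inj_on_subset [OF inj_word])
      then show ?thesis by (simp add: act_power [OF k0] inj_on_def m')
    qed
  qed
  ultimately show ?thesis by blast
qed

text \<open>Expansions have no leading zeros; the extra state \<open>None\<close> absorbs those of words of fixed length.\<close>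

definition padded_transition :: "('q, 'b) automaton \<Rightarrow> 'q option \<Rightarrow> nat \<Rightarrow> 'q option" where
  "padded_transition M q a = (case q of
     None \<Rightarrow> if a = 0 then None else Some (transition M (initial M) a)
   | Some s \<Rightarrow> Some (transition M s a))"

lemma act_padded_transition:
  assumes "k \<ge> 2" "n < k ^ h"
  shows "act (padded_transition M) k h n None
    = (if n = 0 then None else Some (run M (initial M) (expansion k n)))"
  using assms(2)
proof (induction h arbitrary: n)
  case (Suc h)
  have "n div k < k ^ h" using Suc.prems by (intro less_mult_imp_div_less) (simp add: mult.commute)
  note IH = Suc.IH [OF this]
  show ?case
  proof (cases "n div k = 0")
    case True
    then have nk: "n < k" using assms(1) by (auto simp: div_eq_0_iff)
    show ?thesis
      using assms(1) nk IH True
      by (auto simp: padded_transition_def run_def expansion.simps [of k n] expansion.simps [of k 0])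
  next
    case False
    then have "n \<noteq> 0" by (intro notI) simp
    then show ?thesis
      using assms(1) IH False by (auto simp: padded_transition_def run_def expansion.simps [of k n])
  qed
qed simp

text \<open>\<open>min 1 \<epsilon>\<close> replaces \<epsilon> because there are at most N
  differences, so for large \<epsilon> no bound that grows with a power of \<epsilon> can
  hold.\<close>

theorem theoremD:
  fixes l :: nat and A :: "nat set"
  assumes "l \<ge> 3" and "automatic_set A"
  shows "\<exists>C c :: real. c > 0 \<and>
    (\<forall>(N :: nat) (\<epsilon> :: real). N \<ge> 1 \<longrightarrow> \<epsilon> > 0 \<longrightarrow>
      (let \<alpha> = real (card (A \<inter> {..<N})) / real N in
        real (card {m \<in> {..<N}. real (num_aps l A N m) \<ge> (\<alpha> ^ l - \<epsilon>) * real N})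
          \<ge> c * (min 1 \<epsilon>) powr C * real N))"
proof -
  obtain k where k: "k \<ge> 2" and seq: "automatic_seq k (indicator A :: nat \<Rightarrow> nat)"
    using assms(2) by (auto simp: automatic_set_def)
  obtain M :: "(nat, nat) automaton" where M: "finite_automaton k M"
    and A: "\<forall>n. indicator A n = out M (run M (initial M) (expansion k n))"
    using seq unfolding automatic_seq_def by blast
  define S where "S = insert None (Some ` states M)"
  define \<delta> where "\<delta> = padded_transition M"
  \<comment> \<open>\<open>None\<close> is the state of the number 0, whose expansion is empty, so
    it carries the output of the initial state.\<close>
  define F :: "nat option \<Rightarrow> real" where
    "F q = (if out M (case q of None \<Rightarrow> initial M | Some s \<Rightarrow> s) = 1 then 1 else 0)" for q
  have closed: "\<delta> s a \<in> S" if "s \<in> S" "a < k" for s a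
    using that M by (auto simp: S_def \<delta>_def padded_transition_def finite_automaton_def)
  have finS: "finite S" using M by (simp add: S_def finite_automaton_def)
  obtain E d where E: "l \<le> k ^ E" "reset_automaton (k ^ E) d (\<lambda>s a. act \<delta> k E a s) S"
    using reset_word_exists [where \<delta> = \<delta> and l = l, OF k finS closed] by blast
  interpret ra: reset_automaton "k ^ E" d "\<lambda>s a. act \<delta> k E a s" S by (rule E(2))
  obtain D where D: "block_group (k ^ E) d D ra.\<phi>" using ra.block_group_exists by blast
  have zeros: "act \<delta> k h 0 None = None" for h
    by (induction h) (simp_all add: \<delta>_def padded_transition_def)
  interpret ap_counting "k ^ E" d "\<lambda>s a. act \<delta> k E a s" S l D None F
  proof (intro ap_counting.intro ap_counting_axioms.intro E(2) D)
    show "2 \<le> l" using assms(1) by simp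
  qed (use E(1) zeros in \<open>auto simp: S_def F_def\<close>)
  have f: "f n = (if n \<in> A then 1 else 0)" for n
  proof -
    have "n < k ^ (E * n)" using less_power_K [of n] by (simp add: power_mult)
    then have "st n = (if n = 0 then None else Some (run M (initial M) (expansion k n)))"
      unfolding st_def using k by (simp add: act_power \<delta>_def act_padded_transition)
    moreover have "expansion k 0 = []" by (simp add: expansion.simps)
    ultimately have "out M (case st n of None \<Rightarrow> initial M | Some s \<Rightarrow> s) = indicator A n"
      using A [rule_format, of n] by (auto simp: run_def)
    then show ?thesis by (simp add: f_def F_def indicator_def)
  qed
  obtain C c :: real where c: "c > 0"
    and main: "\<forall>(N :: nat) (\<epsilon> :: real). N \<ge> 1 \<longrightarrow> \<epsilon> > 0 \<longrightarrow> \<epsilon> \<le> 1 \<longrightarrow>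
      real (card {m \<in> {..<N}. real (num_aps l A N m)
          \<ge> ((real (card (A \<inter> {..<N})) / real N) ^ l - \<epsilon>) * real N})
        \<ge> c * \<epsilon> powr C * real N"
    using popular_differences [OF f] by (elim exE conjE)
  show ?thesis
  proof (intro exI conjI allI impI)
    show "c > 0" by (rule c)
    fix N :: nat and \<epsilon> :: real
    assume N: "N \<ge> 1" and \<epsilon>: "\<epsilon> > 0"
    define \<alpha> where "\<alpha> = real (card (A \<inter> {..<N})) / real N"
    let ?G = "\<lambda>\<epsilon>. {m \<in> {..<N}. real (num_aps l A N m) \<ge> (\<alpha> ^ l - \<epsilon>) * real N}"
    have le: "(\<alpha> ^ l - \<epsilon>) * real N \<le> (\<alpha> ^ l - min 1 \<epsilon>) * real N" by (intro mult_right_mono) auto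
    have "?G (min 1 \<epsilon>) \<subseteq> ?G \<epsilon>" by (intro Collect_mono) (blast intro: order_trans [OF le])
    then have "card (?G (min 1 \<epsilon>)) \<le> card (?G \<epsilon>)" by (intro card_mono) auto
    moreover have "c * (min 1 \<epsilon>) powr C * real N \<le> real (card (?G (min 1 \<epsilon>)))"
      unfolding \<alpha>_def by (rule main [rule_format, OF N]) (use \<epsilon> in auto)
    ultimately show "let \<alpha> = real (card (A \<inter> {..<N})) / real N in
        real (card {m \<in> {..<N}. real (num_aps l A N m) \<ge> (\<alpha> ^ l - \<epsilon>) * real N})
          \<ge> c * (min 1 \<epsilon>) powr C * real N"
      unfolding Let_def \<alpha>_def [symmetric] by linarith
  qed
qed

end
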